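(* Let $X$ be a simplicial complex of type $S$ which is $\widetilde C$-like and locally determined. Let $\omega=x_1\ldots x_k$ be a local normal form path in $X$ from $x_1$ to $x_k$, let $z$ be an extremal vertex of $X$, and let $d$ be the path metric on the $1$-skeleton of $X$ with unit edge lengths. Then the function $f(i)=d(z,x_i)$, $1\le i\le k$, first decreases (not necessarily strictly) and then strictly increases; that is, there is $j\in\{1,\dots,k\}$ such that $f(i)\ge f(i+1)$ for all $1\le i<j$ and $f(i)<f(i+1)$ for all $j\le i<k$ (either part may be trivial).
   Context: Let $S=\{s_1<s_2<\cdots<s_n\}$ be a finite totally ordered set. A simplicial complex $X$ is of type $S$ if all its maximal simplices have dimension $n-1$ and its vertices carry a type function with values in $\{\hat s_1,\dots,\hat s_n\}$ such that adjacent vertices have different types. Order types by $\hat s_1<\cdots<\hat s_n$ and define on the vertex set $V$: $x<y$ iff $x,y$ are adjacent and $\mathrm{Type}(x)<\mathrm{Type}(y)$. A poset is bowtie free if whenever $x_i<y_j$ for all $i,j\in\{1,2\}$ there is $z$ with $x_i\le z\le y_j$ for all $i,j$. It is upward (downward) flag if any three pairwise upper (lower) bounded elements have a common upper (lower) bound. $X$ is $\widetilde C$-like if it is simply connected, $<$ is a partial order on $V$, and for every $x\in V$ the poset $V_{\ge x}$ is bowtie free and upward flag and the poset $V_{\le x}$ is bowtie free and downward flag. A vertex is extremal if it is of type $\hat s_1$ or $\hat s_n$. $X$ is locally determined if for every pair of vertices $x<y$ there is an extremal vertex $y'$ with $x<y'$ and $y',y$ not comparable, and there is an extremal vertex $x'$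 with $x'<y$ and $x',x$ not comparable. For a vertex $x$, $\mathrm{lk}^-(x,X)$ (resp. $\mathrm{lk}^+(x,X)$) is the full subcomplex of the link of $x$ spanned by the vertices $<x$ (resp. $>x$). An up-down path is an edge path $x_1\ldots x_k$ such that for each $2\le i\le k-1$: $x_{i-1}<x_i$ implies $x_i>x_{i+1}$, and $x_{i-1}>x_i$ implies $x_i<x_{i+1}$. An up-down path $x_1\ldots x_k$ is a local normal form path from $x_1$ to $x_k$ if for each $2\le i\le k-1$: (1) if $x_{i-1}<x_i>x_{i+1}$, there do not exist vertices $a_1=x_{i-1},a_2,a_3,a_4=x_{i+1}$ in $\mathrm{lk}^-(x_i,X)$ with $a_1\le a_2\ge a_3\le a_4$; (2) if $x_{i-1}>x_i<x_{i+1}$, there do not exist vertices $a_1=x_{i-1},a_2,a_3,a_4=x_{i+1}$ in $\mathrm{lk}^+(x_i,X)$ with $a_1\ge a_2\le a_3\ge a_4$. *)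

theory Defs
  imports "HOL-Analysis.Analysis"
begin

section \<open>Abstract simplicial complexes and their geometric realization\<close>

text \<open>A complex is given by its set of (nonempty) simplices. It may be infinite.\<close>

definition abstract_simplicial_complex :: "'a set set \<Rightarrow> bool" where
  "abstract_simplicial_complex X \<longleftrightarrow>
     (\<forall>\<sigma>\<in>X. finite \<sigma> \<and> \<sigma> \<noteq> {}) \<and>
     (\<forall>\<sigma>\<in>X. \<forall>\<rho>. \<rho> \<subseteq> \<sigma> \<and> \<rho> \<noteq> {} \<longrightarrow> \<rho> \<in> X)"

definition vertices :: "'a set set \<Rightarrow> 'a set" where
  "vertices X = \<Union>X"

definition adjacent :: "'a set set \<Rightarrow> 'a \<Rightarrow> 'a \<Rightarrow> bool" where
  "adjacent X u v \<longleftrightarrow> u \<noteq> v \<and> {u, v} \<in> X"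

definition maximal_simplex :: "'a set set \<Rightarrow> 'a set \<Rightarrow> bool" where
  "maximal_simplex X \<sigma> \<longleftrightarrow> \<sigma> \<in> X \<and> (\<forall>\<rho>\<in>X. \<sigma> \<subseteq> \<rho> \<longrightarrow> \<rho> = \<sigma>)"

definition link :: "'a set set \<Rightarrow> 'a \<Rightarrow> 'a set set" where
  "link X x = {\<sigma> \<in> X. x \<notin> \<sigma> \<and> insert x \<sigma> \<in> X}"

definition full_subcomplex :: "'a set set \<Rightarrow> 'a set \<Rightarrow> 'a set set" where
  "full_subcomplex X W = {\<sigma> \<in> X. \<sigma> \<subseteq> W}"

text \<open>The closed geometric simplex spanned by \<open>\<sigma>\<close>, in barycentric coordinates.\<close>

definition geom_simplex :: "'a set \<Rightarrow> ('a \<Rightarrow> real) set" where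
  "geom_simplex \<sigma> = {t. (\<forall>v. 0 \<le> t v) \<and> (\<forall>v. v \<notin> \<sigma> \<longrightarrow> t v = 0) \<and> (\<Sum>v\<in>\<sigma>. t v) = 1}"

text \<open>The geometric realization carries the weak topology: a set is open iff its trace on every
  closed simplex is open. On a closed simplex of a finite vertex set, the subspace topology of the
  product topology on functions is the Euclidean one.\<close>

definition geometric_realization :: "'a set set \<Rightarrow> ('a \<Rightarrow> real) topology" where
  "geometric_realization X = topology (\<lambda>U.
     U \<subseteq> (\<Union>\<sigma>\<in>X. geom_simplex \<sigma>) \<and>
     (\<forall>\<sigma>\<in>X. openin (top_of_set (geom_simplex \<sigma>)) (U \<inter> geom_simplex \<sigma>)))"

lemma openin_geometric_realization:
  "openin (geometric_realization X) U \<longleftrightarrow>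
     U \<subseteq> (\<Union>\<sigma>\<in>X. geom_simplex \<sigma>) \<and>
     (\<forall>\<sigma>\<in>X. openin (top_of_set (geom_simplex \<sigma>)) (U \<inter> geom_simplex \<sigma>))"
proof -
  let ?P = "\<lambda>U. U \<subseteq> (\<Union>\<sigma>\<in>X. geom_simplex \<sigma>) \<and>
     (\<forall>\<sigma>\<in>X. openin (top_of_set (geom_simplex \<sigma>)) (U \<inter> geom_simplex \<sigma>))"
  have "istopology ?P"
    unfolding istopology_def
  proof (intro conjI allI impI)
    fix U V assume "?P U" "?P V"
    then show "U \<inter> V \<subseteq> (\<Union>\<sigma>\<in>X. geom_simplex \<sigma>)" by blast
    show "\<forall>\<sigma>\<in>X. openin (top_of_set (geom_simplex \<sigma>)) (U \<inter> V \<inter> geom_simplex \<sigma>)"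
    proof
      fix \<sigma> assume "\<sigma> \<in> X"
      then have "openin (top_of_set (geom_simplex \<sigma>)) ((U \<inter> geom_simplex \<sigma>) \<inter> (V \<inter> geom_simplex \<sigma>))"
        using \<open>?P U\<close> \<open>?P V\<close> by (blast intro: openin_Int)
      then show "openin (top_of_set (geom_simplex \<sigma>)) (U \<inter> V \<inter> geom_simplex \<sigma>)"
        by (simp add: Int_ac)
    qed
  next
    fix K assume K: "\<forall>U\<in>K. ?P U"
    then show "\<Union>K \<subseteq> (\<Union>\<sigma>\<in>X. geom_simplex \<sigma>)" by blast
    show "\<forall>\<sigma>\<in>X. openin (top_of_set (geom_simplex \<sigma>)) (\<Union>K \<inter> geom_simplex \<sigma>)"
    proof
      fix \<sigma> assume "\<sigma> \<in> X"
      then have "openin (top_of_set (geom_simplex \<sigma>)) (\<Union>U\<in>K. U \<inter> geom_simplex \<sigma>)"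
        using K by (intro openin_Union) auto
      then show "openin (top_of_set (geom_simplex \<sigma>)) (\<Union>K \<inter> geom_simplex \<sigma>)"
        by (simp only: Int_Union2)
    qed
  qed
  then show ?thesis
    by (simp only: geometric_realization_def topology_inverse')
qed

text \<open>This is \<^const>\<open>simply_connected\<close> for an abstract topology: all loops are freely
  homotopic. In particular the space is path connected.\<close>

definition simply_connected_space :: "'b topology \<Rightarrow> bool" where
  "simply_connected_space T \<longleftrightarrow>
     (\<forall>p q. pathin T p \<and> p 1 = p 0 \<and> pathin T q \<and> q 1 = q 0 \<longrightarrow>
        homotopic_with (\<lambda>r. r 1 = r 0) (top_of_set {0..1}) T p q)"

lemma simply_connected_space_top_of_set:
  "simply_connected_space (top_of_set A) \<longleftrightarrow> simply_connected A"
proof -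
  have "pathin (top_of_set A) p \<longleftrightarrow> path p \<and> path_image p \<subseteq> A" for p
    by (auto simp: pathin_def path_def path_image_def continuous_map_in_subtopology)
  then show ?thesis
    by (simp add: simply_connected_space_def simply_connected_def homotopic_loops_def
        pathfinish_def pathstart_def conj_ac)
qed


section \<open>Edge paths and the path metric on the 1-skeleton\<close>

text \<open>Paths \<open>x\<^sub>1 \<dots> x\<^sub>k\<close> are functions of which only the values at \<open>1, \<dots>, k\<close> matter.\<close>

definition edge_path :: "'a set set \<Rightarrow> (nat \<Rightarrow> 'a) \<Rightarrow> nat \<Rightarrow> bool" where
  "edge_path X x k \<longleftrightarrow>
     1 \<le> k \<and> (\<forall>i\<in>{1..k}. x i \<in> vertices X) \<and> (\<forall>i\<in>{1..<k}. adjacent X (x i) (x (i + 1)))"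

text \<open>Distance between vertices. This is only meaningful when \<open>u\<close> and \<open>v\<close> are joined by an
  edge path, which always holds for vertices of a simply connected complex.\<close>

definition path_metric :: "'a set set \<Rightarrow> 'a \<Rightarrow> 'a \<Rightarrow> nat" where
  "path_metric X u v = (LEAST m. \<exists>p. edge_path X p (m + 1) \<and> p 1 = u \<and> p (m + 1) = v)"


section \<open>Complexes of type S\<close>

text \<open>The ordered set of vertex types is a formal copy of \<open>S\<close>, so the type function \<open>\<tau>\<close> is taken to
  have values in \<open>S\<close> itself.\<close>

definition complex_of_type :: "'s::linorder set \<Rightarrow> 'a set set \<Rightarrow> ('a \<Rightarrow> 's) \<Rightarrow> bool" where
  "complex_of_type S X \<tau> \<longleftrightarrow>
     finite S \<and> abstract_simplicial_complex X \<and>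
     (\<forall>\<sigma>. maximal_simplex X \<sigma> \<longrightarrow> card \<sigma> = card S) \<and>
     (\<forall>v\<in>vertices X. \<tau> v \<in> S) \<and>
     (\<forall>u v. adjacent X u v \<longrightarrow> \<tau> u \<noteq> \<tau> v)"

definition vertex_less :: "'a set set \<Rightarrow> ('a \<Rightarrow> 's::linorder) \<Rightarrow> 'a \<Rightarrow> 'a \<Rightarrow> bool" where
  "vertex_less X \<tau> x y \<longleftrightarrow> adjacent X x y \<and> \<tau> x < \<tau> y"

definition vertex_le :: "'a set set \<Rightarrow> ('a \<Rightarrow> 's::linorder) \<Rightarrow> 'a \<Rightarrow> 'a \<Rightarrow> bool" where
  "vertex_le X \<tau> x y \<longleftrightarrow> x = y \<or> vertex_less X \<tau> x y"

definition extremal :: "'s::linorder set \<Rightarrow> 'a set set \<Rightarrow> ('a \<Rightarrow> 's) \<Rightarrow> 'a \<Rightarrow> bool" where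
  "extremal S X \<tau> v \<longleftrightarrow> v \<in> vertices X \<and> (\<tau> v = Min S \<or> \<tau> v = Max S)"

definition lk_minus :: "'a set set \<Rightarrow> ('a \<Rightarrow> 's::linorder) \<Rightarrow> 'a \<Rightarrow> 'a set set" where
  "lk_minus X \<tau> x = full_subcomplex (link X x) {v. vertex_less X \<tau> v x}"

definition lk_plus :: "'a set set \<Rightarrow> ('a \<Rightarrow> 's::linorder) \<Rightarrow> 'a \<Rightarrow> 'a set set" where
  "lk_plus X \<tau> x = full_subcomplex (link X x) {v. vertex_less X \<tau> x v}"


section \<open>Posets, given by a carrier and a reflexive order\<close>

definition bowtie_free :: "'a set \<Rightarrow> ('a \<Rightarrow> 'a \<Rightarrow> bool) \<Rightarrow> bool" where
  "bowtie_free P le \<longleftrightarrow>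
     (\<forall>x\<^sub>1\<in>P. \<forall>x\<^sub>2\<in>P. \<forall>y\<^sub>1\<in>P. \<forall>y\<^sub>2\<in>P.
        (\<forall>x\<in>{x\<^sub>1, x\<^sub>2}. \<forall>y\<in>{y\<^sub>1, y\<^sub>2}. le x y \<and> x \<noteq> y) \<longrightarrow>
        (\<exists>z\<in>P. \<forall>x\<in>{x\<^sub>1, x\<^sub>2}. \<forall>y\<in>{y\<^sub>1, y\<^sub>2}. le x z \<and> le z y))"

definition upper_bounded :: "'a set \<Rightarrow> ('a \<Rightarrow> 'a \<Rightarrow> bool) \<Rightarrow> 'a set \<Rightarrow> bool" where
  "upper_bounded P le A \<longleftrightarrow> (\<exists>b\<in>P. \<forall>a\<in>A. le a b)"

definition lower_bounded :: "'a set \<Rightarrow> ('a \<Rightarrow> 'a \<Rightarrow> bool) \<Rightarrow> 'a set \<Rightarrow> bool" where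
  "lower_bounded P le A \<longleftrightarrow> (\<exists>b\<in>P. \<forall>a\<in>A. le b a)"

definition upward_flag :: "'a set \<Rightarrow> ('a \<Rightarrow> 'a \<Rightarrow> bool) \<Rightarrow> bool" where
  "upward_flag P le \<longleftrightarrow>
     (\<forall>u\<in>P. \<forall>v\<in>P. \<forall>w\<in>P.
        upper_bounded P le {u, v} \<and> upper_bounded P le {v, w} \<and> upper_bounded P le {u, w} \<longrightarrow>
        upper_bounded P le {u, v, w})"

definition downward_flag :: "'a set \<Rightarrow> ('a \<Rightarrow> 'a \<Rightarrow> bool) \<Rightarrow> bool" where
  "downward_flag P le \<longleftrightarrow>
     (\<forall>u\<in>P. \<forall>v\<in>P. \<forall>w\<in>P.
        lower_bounded P le {u, v} \<and> lower_bounded P le {v, w} \<and> lower_bounded P le {u, w} \<longrightarrow>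
        lower_bounded P le {u, v, w})"


section \<open>The C-tilde-like and locally determined conditions\<close>

definition C_tilde_like :: "'a set set \<Rightarrow> ('a \<Rightarrow> 's::linorder) \<Rightarrow> bool" where
  "C_tilde_like X \<tau> \<longleftrightarrow>
     simply_connected_space (geometric_realization X) \<and>
     partial_order_on (vertices X) (relation_of (vertex_le X \<tau>) (vertices X)) \<and>
     (\<forall>x\<in>vertices X.
        bowtie_free {v \<in> vertices X. vertex_le X \<tau> x v} (vertex_le X \<tau>) \<and>
        upward_flag {v \<in> vertices X. vertex_le X \<tau> x v} (vertex_le X \<tau>) \<and>
        bowtie_free {v \<in> vertices X. vertex_le X \<tau> v x} (vertex_le X \<tau>) \<and>
        downward_flag {v \<in> vertices X. vertex_le X \<tau> v x} (vertex_le X \<tau>))"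

definition comparable :: "'a set set \<Rightarrow> ('a \<Rightarrow> 's::linorder) \<Rightarrow> 'a \<Rightarrow> 'a \<Rightarrow> bool" where
  "comparable X \<tau> x y \<longleftrightarrow> vertex_le X \<tau> x y \<or> vertex_le X \<tau> y x"

definition locally_determined :: "'s::linorder set \<Rightarrow> 'a set set \<Rightarrow> ('a \<Rightarrow> 's) \<Rightarrow> bool" where
  "locally_determined S X \<tau> \<longleftrightarrow>
     (\<forall>x\<in>vertices X. \<forall>y\<in>vertices X. vertex_less X \<tau> x y \<longrightarrow>
        (\<exists>y'. extremal S X \<tau> y' \<and> vertex_less X \<tau> x y' \<and> \<not> comparable X \<tau> y' y) \<and>
        (\<exists>x'. extremal S X \<tau> x' \<and> vertex_less X \<tau> x' y \<and> \<not> comparable X \<tau> x' x))"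


section \<open>Up-down paths and local normal form paths\<close>

definition up_down_path :: "'a set set \<Rightarrow> ('a \<Rightarrow> 's::linorder) \<Rightarrow> (nat \<Rightarrow> 'a) \<Rightarrow> nat \<Rightarrow> bool" where
  "up_down_path X \<tau> x k \<longleftrightarrow>
     edge_path X x k \<and>
     (\<forall>i. 2 \<le> i \<and> i \<le> k - 1 \<longrightarrow>
        (vertex_less X \<tau> (x (i - 1)) (x i) \<longrightarrow> vertex_less X \<tau> (x (i + 1)) (x i)) \<and>
        (vertex_less X \<tau> (x i) (x (i - 1)) \<longrightarrow> vertex_less X \<tau> (x i) (x (i + 1))))"

definition local_normal_form_path ::
    "'a set set \<Rightarrow> ('a \<Rightarrow> 's::linorder) \<Rightarrow> (nat \<Rightarrow> 'a) \<Rightarrow> nat \<Rightarrow> bool" where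
  "local_normal_form_path X \<tau> x k \<longleftrightarrow>
     up_down_path X \<tau> x k \<and>
     (\<forall>i. 2 \<le> i \<and> i \<le> k - 1 \<longrightarrow>
        (vertex_less X \<tau> (x (i - 1)) (x i) \<and> vertex_less X \<tau> (x (i + 1)) (x i) \<longrightarrow>
           \<not> (\<exists>a\<^sub>1 a\<^sub>2 a\<^sub>3 a\<^sub>4. a\<^sub>1 = x (i - 1) \<and> a\<^sub>4 = x (i + 1) \<and>
                {a\<^sub>1, a\<^sub>2, a\<^sub>3, a\<^sub>4} \<subseteq> vertices (lk_minus X \<tau> (x i)) \<and>
                vertex_le X \<tau> a\<^sub>1 a\<^sub>2 \<and> vertex_le X \<tau> a\<^sub>3 a\<^sub>2 \<and> vertex_le X \<tau> a\<^sub>3 a\<^sub>4)) \<and>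
        (vertex_less X \<tau> (x i) (x (i - 1)) \<and> vertex_less X \<tau> (x i) (x (i + 1)) \<longrightarrow>
           \<not> (\<exists>a\<^sub>1 a\<^sub>2 a\<^sub>3 a\<^sub>4. a\<^sub>1 = x (i - 1) \<and> a\<^sub>4 = x (i + 1) \<and>
                {a\<^sub>1, a\<^sub>2, a\<^sub>3, a\<^sub>4} \<subseteq> vertices (lk_plus X \<tau> (x i)) \<and>
                vertex_le X \<tau> a\<^sub>2 a\<^sub>1 \<and> vertex_le X \<tau> a\<^sub>2 a\<^sub>3 \<and> vertex_le X \<tau> a\<^sub>4 a\<^sub>3)))"

end

theory Submission
  imports Defs
begin

text \<open>
  Say that \<open>z\<close> is of minimal type. A path \<open>z < y\<^sub>1 > y\<^sub>2 < \<dots>\<close> is a gate path if every \<open>y\<^sub>i\<close> is the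
  vertex closest to \<open>y\<^sub>i\<^sub>+\<^sub>1\<close>, among the vertices below (above) \<open>y\<^sub>i\<^sub>+\<^sub>1\<close>, of the next smaller ball around
  \<open>z\<close>. This turns out to be a local condition at \<open>y\<^sub>i\<close>: the one for local normal form paths, read towards \<open>z\<close>.
  Comparing gate paths termwise makes the set of all of them a poset, and by the bowtie and flag
  conditions the projection to the last vertex has unique lifts of comparable pairs: it is a
  covering of \<open>X\<close>. As \<open>X\<close> is simply connected, every vertex \<open>u\<close> is the end of exactly one gate path, whose
  length is \<open>d(z, u)\<close>. If now \<open>d(z, x\<^sub>i\<^sub>-\<^sub>1) < d(z, x\<^sub>i) \<ge> d(z, x\<^sub>i\<^sub>+\<^sub>1)\<close>, then the gate of \<open>x\<^sub>i\<close> and the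
  gate of \<open>x\<^sub>i\<^sub>+\<^sub>1\<close> (or \<open>x\<^sub>i\<^sub>+\<^sub>1\<close> itself) are the vertices \<open>a\<^sub>2\<close> and \<open>a\<^sub>3\<close> which a local normal form path must
  not have.
\<close>

section \<open>Monodromy of coverings of simply connected complexes\<close>

lemma simplex_face:
  "abstract_simplicial_complex X \<Longrightarrow> \<sigma> \<in> X \<Longrightarrow> \<rho> \<subseteq> \<sigma> \<Longrightarrow> \<rho> \<noteq> {} \<Longrightarrow> \<rho> \<in> X"
  unfolding abstract_simplicial_complex_def by blast

section \<open>Coordinates and open stars in the geometric realization\<close>

lemma topspace_geometric_realization:
  "topspace (geometric_realization X) = (\<Union>\<sigma>\<in>X. geom_simplex \<sigma>)"
proof
  show "topspace (geometric_realization X) \<subseteq> (\<Union>\<sigma>\<in>X. geom_simplex \<sigma>)"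
    using openin_topspace[of "geometric_realization X"] openin_geometric_realization by blast
  have "(\<Union>\<sigma>\<in>X. geom_simplex \<sigma>) \<inter> geom_simplex \<rho> = geom_simplex \<rho>" if "\<rho> \<in> X" for \<rho>
    using that by blast
  then have "openin (geometric_realization X) (\<Union>\<sigma>\<in>X. geom_simplex \<sigma>)"
    by (simp add: openin_geometric_realization)
  then show "(\<Union>\<sigma>\<in>X. geom_simplex \<sigma>) \<subseteq> topspace (geometric_realization X)"
    by (rule openin_subset)
qed

lemma continuous_on_coordinate: "continuous_on A (\<lambda>t. (t :: 'a \<Rightarrow> 'b::topological_space) v)"
  by (intro continuous_on_product_coordinates[THEN continuous_on_subset]) auto

text \<open>In the weak topology openness is checked on one closed simplex at a time, and there the
  coordinate \<open>v\<close> is continuous.\<close>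

lemma openin_open_star:
  "openin (geometric_realization X) {t \<in> topspace (geometric_realization X). t v > 0}"
  unfolding openin_geometric_realization
proof (intro conjI ballI)
  fix \<sigma> assume "\<sigma> \<in> X"
  then have eq: "{t \<in> topspace (geometric_realization X). t v > 0} \<inter> geom_simplex \<sigma> =
      geom_simplex \<sigma> \<inter> (\<lambda>t. t v) -` {0<..}"
    by (auto simp: topspace_geometric_realization)
  show "openin (top_of_set (geom_simplex \<sigma>))
      ({t \<in> topspace (geometric_realization X). t v > 0} \<inter> geom_simplex \<sigma>)"
    unfolding eq by (intro continuous_openin_preimage_gen continuous_on_coordinate) simp
qed (auto simp: topspace_geometric_realization)

text \<open>The support of a point lies in one simplex. This turns a common point of several open
  stars into a simplex on their vertices.\<close>

lemma positive_coordinates_simplex: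
  assumes "abstract_simplicial_complex X" "t \<in> topspace (geometric_realization X)"
    and "A \<noteq> {}" "\<And>v. v \<in> A \<Longrightarrow> t v > 0"
  shows "A \<in> X"
proof -
  obtain \<sigma> where \<sigma>: "\<sigma> \<in> X" "t \<in> geom_simplex \<sigma>"
    using assms(2) by (auto simp: topspace_geometric_realization)
  then have "A \<subseteq> \<sigma>"
    using assms(4) by (force simp: geom_simplex_def)
  then show ?thesis
    using simplex_face[OF assms(1) \<sigma>(1)] assms(3) by blast
qed

lemma exists_positive_coordinate:
  assumes "t \<in> topspace (geometric_realization X)" shows "\<exists>v. t v > 0"
proof -
  obtain \<sigma> where t: "t \<in> geom_simplex \<sigma>"
    using assms by (auto simp: topspace_geometric_realization)
  then have "(\<Sum>v\<in>\<sigma>. t v) \<noteq> 0" "\<And>v. t v \<ge> 0" by (auto simp: geom_simplex_def)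
  then show ?thesis by (metis less_eq_real_def sum.neutral)
qed

lemma continuous_map_closed_simplex:
  assumes "\<sigma> \<in> X"
  shows "continuous_map (top_of_set (geom_simplex \<sigma>)) (geometric_realization X) id"
  unfolding continuous_map_def
proof (intro conjI allI impI)
  show "id \<in> topspace (top_of_set (geom_simplex \<sigma>)) \<rightarrow> topspace (geometric_realization X)"
    using assms by (auto simp: topspace_geometric_realization)
  fix U assume "openin (geometric_realization X) U"
  then have "openin (top_of_set (geom_simplex \<sigma>)) (U \<inter> geom_simplex \<sigma>)"
    using assms by (simp add: openin_geometric_realization)
  moreover have "{x \<in> topspace (top_of_set (geom_simplex \<sigma>)). id x \<in> U} = U \<inter> geom_simplex \<sigma>"
    by auto
  ultimately show "openin (top_of_set (geom_simplex \<sigma>))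
      {x \<in> topspace (top_of_set (geom_simplex \<sigma>)). id x \<in> U}" by simp
qed

section \<open>Edge paths as continuous paths\<close>

definition edge_point :: "'a \<Rightarrow> 'a \<Rightarrow> real \<Rightarrow> 'a \<Rightarrow> real" where
  "edge_point u v r = (\<lambda>w. (1 - r) * of_bool (w = u) + r * of_bool (w = v))"

lemma edge_point_pos: "edge_point u v r w > 0 \<Longrightarrow> w = u \<or> w = v"
  and edge_point_pos_0: "edge_point u v 0 w > 0 \<Longrightarrow> w = u"
  and edge_point_pos_1: "edge_point u v 1 w > 0 \<Longrightarrow> w = v"
  by (cases "w = u"; cases "w = v"; simp add: edge_point_def)+

text \<open>A sum of tent functions, which makes continuity of the coordinates immediate.\<close>

definition polygon :: "(nat \<Rightarrow> 'a) \<Rightarrow> nat \<Rightarrow> real \<Rightarrow> 'a \<Rightarrow> real" where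
  "polygon x k r = (\<lambda>w. \<Sum>i\<le>k. max 0 (1 - \<bar>r * real k - real i\<bar>) * of_bool (w = x i))"

text \<open>Between the breakpoints \<open>i\<close> and \<open>Suc i\<close> all other tents
  vanish.\<close>

lemma polygon_piece:
  assumes "i < k" "real i \<le> r * real k" "r * real k \<le> real (Suc i)"
  shows "polygon x k r = edge_point (x i) (x (Suc i)) (r * real k - real i)"
proof
  fix w
  let ?f = "\<lambda>j. max 0 (1 - \<bar>r * real k - real j\<bar>) * of_bool (w = x j)"
  have "polygon x k r w = (\<Sum>j\<in>{i, Suc i}. ?f j)"
    unfolding polygon_def
  proof (rule sum.mono_neutral_right)
    show "\<forall>j\<in>{..k} - {i, Suc i}. ?f j = 0"
    proof
      fix j assume "j \<in> {..k} - {i, Suc i}"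
      then have "j < i \<or> j > Suc i" by auto
      then have "real j + 1 \<le> real i \<or> real j \<ge> real i + 2" by linarith
      then have "1 - \<bar>r * real k - real j\<bar> \<le> 0" using assms(2,3) by auto
      then show "?f j = 0" by simp
    qed
  qed (use assms(1) in auto)
  also have "\<dots> = edge_point (x i) (x (Suc i)) (r * real k - real i) w"
    using assms(2,3) by (simp add: edge_point_def max_def)
  finally show "polygon x k r w = edge_point (x i) (x (Suc i)) (r * real k - real i) w" .
qed

lemma edge_point_in_simplex:
  assumes "0 \<le> r" "r \<le> 1" shows "edge_point u v r \<in> geom_simplex {u, v}"
  using assms by (cases "u = v") (auto simp: geom_simplex_def edge_point_def algebra_simps)

text \<open>Coordinatewise continuity only controls the product topology. So each piece is first
  mapped into a single closed simplex, which maps continuously into the realization, and then the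
  pieces are pasted.\<close>

lemma pathin_polygon:
  assumes k: "k > 0" and edge: "\<And>i. i < k \<Longrightarrow> {x i, x (Suc i)} \<in> X"
  shows "pathin (geometric_realization X) (polygon x k)"
  unfolding pathin_def
proof (rule pasting_lemma_closed[where I = "{..<k}" and f = "\<lambda>_. polygon x k"
      and T = "\<lambda>i. {real i / real k .. real (Suc i) / real k} \<inter> {0..1}"])
  fix i assume i: "i \<in> {..<k}"
  let ?T = "{real i / real k .. real (Suc i) / real k} \<inter> {0..1}"
  show "closedin (top_of_set {0..1}) ?T"
    by (metis closed_atLeastAtMost closedin_closed_Int Int_commute)
  have piece: "real i \<le> r * real k" "r * real k \<le> real (Suc i)" if "r \<in> ?T" for r
    using that k by (auto simp: field_simps)
  have "continuous_on ?T (\<lambda>r. polygon x k r w)" for w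
    unfolding polygon_def by (intro continuous_intros)
  then have "continuous_on ?T (polygon x k)"
    by (rule continuous_on_coordinatewise_then_product)
  moreover have "polygon x k r \<in> geom_simplex {x i, x (Suc i)}" if "r \<in> ?T" for r
    using polygon_piece[of i k r x] piece[OF that] i edge_point_in_simplex[of "r * real k - real i"]
    by auto
  ultimately have "continuous_map (top_of_set ?T) (top_of_set (geom_simplex {x i, x (Suc i)})) (polygon x k)"
    by (auto simp: continuous_map_in_subtopology)
  then have "continuous_map (top_of_set ?T) (geometric_realization X) (id \<circ> polygon x k)"
    using continuous_map_compose continuous_map_closed_simplex edge i by blast
  then show "continuous_map (subtopology (top_of_set {0..1}) ?T) (geometric_realization X) (polygon x k)"
    by (simp add: subtopology_subtopology Int_ac)
next
  fix r :: real assume "r \<in> topspace (top_of_set {0..1})"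
  then have r: "0 \<le> r" "r \<le> 1" by auto
  \<comment> \<open>The minimum handles \<open>r = 1\<close>, where the floor would name a piece
    \<open>k\<close> that does not exist.\<close>
  define i where "i = min (k - 1) (nat \<lfloor>r * real k\<rfloor>)"
  have i: "i < k" using k by (auto simp: i_def)
  have lower: "real i \<le> r * real k"
    using r unfolding i_def by (metis mult_nonneg_nonneg of_nat_0_le_iff of_nat_floor of_nat_le_iff min.cobounded2 order_trans)
  have "r * real k \<le> real (Suc i)"
  proof (cases "nat \<lfloor>r * real k\<rfloor> \<le> k - 1")
    case True
    then have "i = nat \<lfloor>r * real k\<rfloor>" by (simp add: i_def)
    then show ?thesis by linarith
  next
    case False
    then have "Suc i = k" using k by (simp add: i_def)
    then show ?thesis using r k by (simp add: mult_left_le_one_le)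
  qed
  then show "\<exists>j. j \<in> {..<k} \<and> r \<in> {real j / real k .. real (Suc j) / real k} \<inter> {0..1} \<and>
      polygon x k r = polygon x k r"
    using i lower r k by (intro exI[of _ i]) (auto simp: field_simps)
qed auto

text \<open>The size of the grid comes from a Lebesgue number of the cover by preimages of open stars.\<close>

lemma grid_of_vertices:
  assumes h: "continuous_map (prod_topology (top_of_set {0..1}) (top_of_set {0..1}))
      (geometric_realization X) h" and k: "k > 0"
  obtains n c where "n > 0" "k dvd n"
    "\<forall>i j r t. i < n \<longrightarrow> j < n \<longrightarrow> real i \<le> r * real n \<longrightarrow> r * real n \<le> real (Suc i) \<longrightarrow>
       real j \<le> t * real n \<longrightarrow> t * real n \<le> real (Suc j) \<longrightarrow> h (r, t) (c i j) > (0 :: real)"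
proof -
  let ?S = "{0..1::real} \<times> {0..1::real}"
  have h': "continuous_map (top_of_set ?S) (geometric_realization X) h"
    using h by (simp add: prod_topology_subtopology_eu)
  have "\<exists>G. open G \<and> {s \<in> ?S. h s v > 0} = ?S \<inter> G" for v
  proof -
    have "openin (top_of_set ?S) {s \<in> topspace (top_of_set ?S).
        h s \<in> {t \<in> topspace (geometric_realization X). t v > 0}}"
      by (rule openin_continuous_map_preimage[OF h' openin_open_star])
    moreover have "{s \<in> topspace (top_of_set ?S). h s \<in> {t \<in> topspace (geometric_realization X). t v > 0}}
        = {s \<in> ?S. h s v > 0}"
      using continuous_map_image_subset_topspace[OF h'] by auto
    ultimately show ?thesis by (simp only: openin_open)
  qed
  then obtain G where G: "\<And>v. open (G v)" "\<And>v. {s \<in> ?S. h s v > 0} = ?S \<inter> G v" by metis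
  have "?S \<subseteq> \<Union>(range G)"
  proof
    fix s assume s: "s \<in> ?S"
    then have "h s \<in> topspace (geometric_realization X)"
      using continuous_map_image_subset_topspace[OF h'] by auto
    then obtain v where "h s v > 0" using exists_positive_coordinate by blast
    then show "s \<in> \<Union>(range G)" using G(2)[of v] s by blast
  qed
  moreover have "compact ?S" by (intro compact_Times compact_Icc)
  moreover have "open U" if "U \<in> range G" for U using that G(1) by auto
  ultimately obtain \<epsilon> where \<epsilon>: "0 < \<epsilon>" "\<And>s. s \<in> ?S \<Longrightarrow> \<exists>U\<in>range G. ball s \<epsilon> \<subseteq> U"
    using Heine_Borel_lemma[of ?S "range G"] by blast
  obtain m :: nat where m: "real m > 2 / \<epsilon>" using reals_Archimedean2 by blast
  \<comment> \<open>The factor \<open>m + 1\<close> makes the cells small compared with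
    \<open>\<epsilon>\<close>; the factor \<open>k\<close> puts the breakpoints of a polygon with
    \<open>k\<close> edges on grid lines.\<close>
  define n where "n = k * (m + 1)"
  have n: "n > 0" "k dvd n" using k by (auto simp: n_def)
  have "real n \<ge> real (m + 1)"
    using k mult_le_mono1[of 1 k "m + 1"] unfolding n_def by (intro of_nat_mono) simp
  then have "2 / \<epsilon> < real n" using m by simp
  then have \<epsilon>n: "2 / real n < \<epsilon>" using \<epsilon>(1) n by (simp add: field_simps)
  have "\<exists>v. ball (real i / real n, real j / real n) \<epsilon> \<subseteq> G v" if "i < n" "j < n" for i j
    using \<epsilon>(2)[of "(real i / real n, real j / real n)"] that by auto
  \<comment> \<open>The open star of \<open>c i j\<close> will contain the image of the whole cell
    with lower left corner \<open>(i / n, j / n)\<close>.\<close>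
  then obtain c where c: "\<And>i j. i < n \<Longrightarrow> j < n \<Longrightarrow> ball (real i / real n, real j / real n) \<epsilon> \<subseteq> G (c i j)"
    by metis
  show ?thesis
  proof (rule that[OF n], intro allI impI)
    fix i j r t assume ij: "i < n" "j < n"
      and r: "real i \<le> r * real n" "r * real n \<le> real (Suc i)"
      and t: "real j \<le> t * real n" "t * real n \<le> real (Suc j)"
    have "r * real n \<le> real n" "t * real n \<le> real n" using ij r t by linarith+
    moreover have "0 \<le> r * real n" "0 \<le> t * real n" using r(1) t(1) by linarith+
    ultimately have S: "(r, t) \<in> ?S" using n by (auto simp: zero_le_mult_iff)
    have near: "dist (real a / real n) q \<le> 1 / real n"
      if "real a \<le> q * real n" "q * real n \<le> real (Suc a)" for a q
    proof -
      have "real a / real n \<le> q" "q \<le> real (Suc a) / real n" using that n by (auto simp: field_simps)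
      then show ?thesis by (simp add: dist_real_def add_divide_distrib)
    qed
    have "dist (real i / real n, real j / real n) (r, t)
        \<le> dist (real i / real n) r + dist (real j / real n) t"
      unfolding dist_Pair_Pair by (rule sqrt_sum_squares_le_sum) auto
    also have "\<dots> \<le> 1 / real n + 1 / real n" using near r t by (intro add_mono) auto
    also have "\<dots> < \<epsilon>" using \<epsilon>n by simp
    finally have "(r, t) \<in> G (c i j)" using c[OF ij] by auto
    then show "h (r, t) (c i j) > 0" using S G(2)[of "c i j"] by blast
  qed
qed

lemma free_homotopyE:
  assumes "homotopic_with (\<lambda>r. r 1 = r 0) (top_of_set {0..1::real}) T p q"
  obtains h where "continuous_map (prod_topology (top_of_set {0..1::real}) (top_of_set {0..1::real})) T h"
    "\<And>t. h (0, t) = p t" "\<And>t. h (1, t) = q t" "\<And>r. r \<in> {0..1} \<Longrightarrow> h (r, 1) = h (r, 0)"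
proof -
  from assms obtain h where
    "continuous_map (prod_topology (top_of_set {0..1::real}) (top_of_set {0..1::real})) T h"
    "\<forall>t. h (0, t) = p t" "\<forall>t. h (1, t) = q t" "\<forall>r\<in>{0..1}. h (r, 1) = h (r, 0)"
    unfolding homotopic_with_def by (elim exE conjE)
  then show ?thesis using that[of h] by simp
qed

text \<open>A free homotopy between the constant loops at \<open>u\<close> and \<open>v\<close>
  contains a path from \<open>u\<close> to \<open>v\<close>. Grid vertices of successive cells along
  it are positive at a common point, so they span a simplex and \<open>P\<close> is passed
  on.\<close>

lemma connected_by_edges:
  assumes X: "abstract_simplicial_complex X"
    and sc: "simply_connected_space (geometric_realization X)"
    and u: "u \<in> vertices X" and v: "v \<in> vertices X"
    and P: "P u" "\<And>a b. P a \<Longrightarrow> {a, b} \<in> X \<Longrightarrow> P b"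
  shows "P v"
proof -
  let ?e = "\<lambda>u. edge_point u u 0"
  let ?T = "geometric_realization X"
  have e: "?e w \<in> topspace ?T" if "w \<in> vertices X" for w
  proof -
    have "{w} \<in> X" using that unfolding vertices_def by (auto intro: simplex_face[OF X])
    moreover have "?e w \<in> geom_simplex {w}" using edge_point_in_simplex[of 0 w w] by simp
    ultimately show ?thesis unfolding topspace_geometric_realization by blast
  qed
  have "pathin ?T (\<lambda>_::real. ?e u)" "pathin ?T (\<lambda>_. ?e v)"
    using e[OF u] e[OF v] by (simp_all add: pathin_const)
  then have "homotopic_with (\<lambda>r. r 1 = r 0) (top_of_set {0..1::real}) ?T (\<lambda>_. ?e u) (\<lambda>_. ?e v)"
    using sc[unfolded simply_connected_space_def, rule_format, of "\<lambda>_. ?e u" "\<lambda>_. ?e v"] by simp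
  then obtain h where
    h: "continuous_map (prod_topology (top_of_set {0..1::real}) (top_of_set {0..1::real})) ?T h"
    and h0: "\<And>t. h (0, t) = ?e u" and h1: "\<And>t. h (1, t) = ?e v"
    by (rule free_homotopyE) blast
  obtain n c where n: "n > 0" "1 dvd n" and
    grid: "\<forall>i j r t. i < n \<longrightarrow> j < n \<longrightarrow> real i \<le> r * real n \<longrightarrow> r * real n \<le> real (Suc i) \<longrightarrow>
       real j \<le> t * real n \<longrightarrow> t * real n \<le> real (Suc j) \<longrightarrow> h (r, t) (c i j) > 0"
    by (rule grid_of_vertices[OF h zero_less_one])
  note c = grid[rule_format]
  have top: "h (r, 0) \<in> topspace ?T" if "0 \<le> r" "r \<le> 1" for r
    using continuous_map_image_subset_topspace[OF h] that by (auto simp: image_subset_iff)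
  have "?e u (c 0 0) > 0" using c[of 0 0 0 0] n h0 by simp
  then have "c 0 0 = u" by (rule edge_point_pos_0)
  have "P (c i 0)" if "i < n" for i
    using that
  proof (induction i)
    case 0
    then show ?case using \<open>c 0 0 = u\<close> P(1) by simp
  next
    case (Suc i)
    let ?r = "real (Suc i) / real n"
    have "{c i 0, c (Suc i) 0} \<in> X"
    proof (rule positive_coordinates_simplex[OF X top[of ?r]])
      fix w assume "w \<in> {c i 0, c (Suc i) 0}"
      then show "h (?r, 0) w > 0"
        using c[of i 0 ?r 0] c[of "Suc i" 0 ?r 0] Suc.prems by auto
    qed (use Suc.prems in auto)
    then show ?case using Suc P(2) by simp
  qed
  moreover have "?e v (c (n - 1) 0) > 0" using c[of "n - 1" 0 1 0] n h1 by simp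
  then have "c (n - 1) 0 = v" by (rule edge_point_pos_0)
  ultimately show ?thesis using n by (metis diff_less zero_less_one)
qed

text \<open>Only the edges of the covering are recorded. \<open>E\<close> stands for equality or
  adjacency upstairs, so \<open>{p a, p b}\<close> may be a single vertex.\<close>

locale simplicial_covering =
  fixes X :: "'a set set" and C :: "'b set" and p :: "'b \<Rightarrow> 'a" and E :: "'b \<Rightarrow> 'b \<Rightarrow> bool"
  assumes complex: "abstract_simplicial_complex X"
    and E_carrier: "E a b \<Longrightarrow> a \<in> C \<and> b \<in> C"
    and E_refl: "a \<in> C \<Longrightarrow> E a a"
    and E_sym: "E a b \<Longrightarrow> E b a"
    and E_simplex: "E a b \<Longrightarrow> {p a, p b} \<in> X"
    and lift_unique: "E a b \<Longrightarrow> E a b' \<Longrightarrow> p b = p b' \<Longrightarrow> b = b'"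
    and lift_exists: "a \<in> C \<Longrightarrow> {p a, v} \<in> X \<Longrightarrow> \<exists>b. E a b \<and> p b = v"
    and triangle: "E a b \<Longrightarrow> E b c \<Longrightarrow> {p a, p b, p c} \<in> X \<Longrightarrow> E a c"
begin

text \<open>The square is cut along the diagonal from \<open>a'\<close> to \<open>b\<close> into two
  triangles.\<close>

lemma quadrangle:
  assumes "E a b" "E a a'" "E b b'" "{p a, p b, p a', p b'} \<in> X"
  shows "E a' b'"
proof -
  have face: "\<rho> \<in> X" if "\<rho> \<noteq> {}" "\<rho> \<subseteq> {p a, p b, p a', p b'}" for \<rho>
    using simplex_face[OF complex assms(4)] that by blast
  have "E a' b"
    by (rule triangle[OF E_sym[OF assms(2)] assms(1) face]) auto
  then show ?thesis
    by (rule triangle[OF _ assms(3) face]) auto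
qed

text \<open>\<open>closes v m\<close> says that the closed edge path \<open>v 0, \<dots>, v m, v 0\<close> has trivial monodromy.\<close>

definition closes :: "(nat \<Rightarrow> 'a) \<Rightarrow> nat \<Rightarrow> bool" where
  "closes v m \<longleftrightarrow> (\<forall>l. (\<forall>j\<le>m. l j \<in> C \<and> p (l j) = v j) \<longrightarrow> (\<forall>j<m. E (l j) (l (Suc j))) \<longrightarrow> E (l m) (l 0))"

text \<open>By \<open>triangle\<close>, every \<open>l j\<close> stays adjacent or equal to the
  start \<open>l 0\<close>.\<close>

lemma closes_in_simplex:
  assumes \<sigma>: "\<sigma> \<in> X" and v: "\<And>j. j \<le> m \<Longrightarrow> v j \<in> \<sigma>"
  shows "closes v m"
  unfolding closes_def
proof (intro allI impI)
  fix l assume l: "\<forall>j\<le>m. l j \<in> C \<and> p (l j) = v j" "\<forall>j<m. E (l j) (l (Suc j))"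
  have "E (l 0) (l j)" if "j \<le> m" for j
    using that
  proof (induction j)
    case 0
    then show ?case using l E_refl by simp
  next
    case (Suc j)
    have "{p (l 0), p (l j), p (l (Suc j))} \<subseteq> \<sigma>" using v l(1) Suc.prems by simp
    then have "{p (l 0), p (l j), p (l (Suc j))} \<in> X"
      using simplex_face[OF complex \<sigma>] by blast
    then show ?case using triangle[of "l 0" "l j" "l (Suc j)"] Suc l(2) by simp
  qed
  then show "E (l m) (l 0)" using E_sym by blast
qed

text \<open>A lift of \<open>v\<close> is moved vertex by vertex to a lift of \<open>w\<close>. By
  \<open>quadrangle\<close> its edges are carried along, and the closing edge is carried
  back.\<close>

lemma closes_neighbour:
  assumes w: "closes w m"
    and sq: "\<And>j. j < m \<Longrightarrow> {v j, v (Suc j), w j, w (Suc j)} \<in> X"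
    and last: "{v m, v 0, w m, w 0} \<in> X"
  shows "closes v m"
  unfolding closes_def
proof (intro allI impI)
  fix l assume l: "\<forall>j\<le>m. l j \<in> C \<and> p (l j) = v j" "\<forall>j<m. E (l j) (l (Suc j))"
  have "\<exists>b. E (l j) b \<and> p b = w j" if "j \<le> m" for j
  proof (rule lift_exists)
    show "{p (l j), w j} \<in> X"
    proof (cases "j = m")
      case True
      then show ?thesis using l(1) by (intro simplex_face[OF complex last]) auto
    next
      case False
      then show ?thesis using that l(1) by (intro simplex_face[OF complex sq[of j]]) auto
    qed
  qed (use l that in blast)
  then obtain l' where l': "\<And>j. j \<le> m \<Longrightarrow> E (l j) (l' j)" "\<And>j. j \<le> m \<Longrightarrow> p (l' j) = w j" by metis
  have "E (l' j) (l' (Suc j))" if "j < m" for j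
    by (rule quadrangle[of "l j" "l (Suc j)"]) (use l l' sq that in auto)
  moreover have "\<forall>j\<le>m. l' j \<in> C \<and> p (l' j) = w j" using l' E_carrier by blast
  ultimately have "E (l' m) (l' 0)" using w unfolding closes_def by blast
  moreover have "{p (l' m), p (l' 0), p (l m), p (l 0)} = {v m, v 0, w m, w 0}"
    using l(1) l'(2) by auto
  ultimately show "E (l m) (l 0)"
    using quadrangle[of "l' m" "l' 0" "l m" "l 0"] last E_sym[OF l'(1)] by simp
qed

text \<open>A free homotopy contracts the loop to a constant one. The row of grid vertices at the
  constant end closes up, and each row passes this on to its neighbour, until the row along the
  given loop is reached, which is lifted by means of \<open>l\<close>.\<close>

theorem trivial_monodromy:
  assumes sc: "simply_connected_space (geometric_realization X)" and k: "k > 0"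
    and l: "\<And>i. i < k \<Longrightarrow> E (l i) (l (Suc i))" and loop: "p (l k) = p (l 0)"
  shows "l k = l 0"
proof -
  let ?T = "geometric_realization X" and ?x = "\<lambda>i. p (l i)"
  let ?q = "polygon ?x k"
  have path: "pathin ?T ?q" by (rule pathin_polygon[OF k]) (rule E_simplex[OF l])
  have vertex: "?q (real i / real k) w > 0 \<Longrightarrow> w = ?x i" if "i \<le> k" for i w
  proof -
    assume pos: "?q (real i / real k) w > 0"
    show "w = ?x i"
    proof (cases "i = k")
      case True
      then show ?thesis
        using pos k polygon_piece[of "k - 1" k 1 ?x]
        by (auto simp: of_nat_diff dest: edge_point_pos_1)
    next
      case False
      then show ?thesis
        using pos k that polygon_piece[of i k "real i / real k" ?x]
        by (auto dest: edge_point_pos_0)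
    qed
  qed
  have q01: "?q 1 = ?q 0"
    using polygon_piece[of "k - 1" k 1 ?x] polygon_piece[of 0 k 0 ?x] k loop
    by (auto simp: edge_point_def)
  have q0: "?q 0 \<in> topspace ?T"
    using continuous_map_image_subset_topspace[OF path[unfolded pathin_def]]
    by (auto simp: image_subset_iff)
  then have const: "pathin ?T (\<lambda>_. ?q 0)" by (simp add: pathin_const)
  have "homotopic_with (\<lambda>r. r 1 = r 0) (top_of_set {0..1}) ?T ?q (\<lambda>_. ?q 0)"
    using sc path const q01 unfolding simply_connected_space_def by blast
  then obtain h where
    h: "continuous_map (prod_topology (top_of_set {0..1::real}) (top_of_set {0..1::real})) ?T h"
    and h0: "\<And>t. h (0, t) = ?q t" and h1: "\<And>t. h (1, t) = ?q 0"
    and hl: "\<And>r. r \<in> {0..1} \<Longrightarrow> h (r, 1) = h (r, 0)"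
    by (rule free_homotopyE) blast
  obtain n c where n: "n > 0" "k dvd n" and
    grid: "\<forall>i j r t. i < n \<longrightarrow> j < n \<longrightarrow> real i \<le> r * real n \<longrightarrow> r * real n \<le> real (Suc i) \<longrightarrow>
       real j \<le> t * real n \<longrightarrow> t * real n \<le> real (Suc j) \<longrightarrow> h (r, t) (c i j) > 0"
    by (rule grid_of_vertices[OF h k])
  note c = grid[rule_format]
  define m where "m = n - 1"
  have m: "n = Suc m" using n by (simp add: m_def)
  have top: "h (r, t) \<in> topspace ?T" if "0 \<le> r" "r \<le> 1" "0 \<le> t" "t \<le> 1" for r t
    using continuous_map_image_subset_topspace[OF h] that by (auto simp: image_subset_iff)
  \<comment> \<open>Rows are numbered by the homotopy parameter. The last one lies in the support of
    the point \<open>?q 0\<close>, which is a simplex.\<close>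
  have closes_row: "closes (c (m - i)) m" if "i \<le> m" for i
    using that
  proof (induction i)
    case 0
    let ?s = "{w. ?q 0 w > 0}"
    have pos: "c m j \<in> ?s" if "j \<le> m" for j
      using c[of m j 1 "real j / real n"] that m h1 by simp
    have "?s \<in> X"
    proof (rule positive_coordinates_simplex[OF complex q0])
      show "?s \<noteq> {}" using pos[of 0] by blast
    qed simp
    then show ?case using closes_in_simplex[of ?s] pos by simp
  next
    case (Suc i)
    let ?i = "m - Suc i"
    have i: "Suc ?i = m - i" "Suc ?i < n" using Suc.prems m by auto
    let ?r = "real (Suc ?i) / real n"
    have r: "0 \<le> ?r" "?r \<le> 1" using i(2) by auto
    show ?case
    proof (rule closes_neighbour)
      show "closes (c (Suc ?i)) m" using Suc i by simp
    next
      fix j assume j: "j < m"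
      let ?t = "real (Suc j) / real n"
      show "{c ?i j, c ?i (Suc j), c (Suc ?i) j, c (Suc ?i) (Suc j)} \<in> X"
      proof (rule positive_coordinates_simplex[OF complex top[of ?r ?t]])
        fix w assume "w \<in> {c ?i j, c ?i (Suc j), c (Suc ?i) j, c (Suc ?i) (Suc j)}"
        then show "h (?r, ?t) w > 0"
          using c[of ?i j ?r ?t] c[of ?i "Suc j" ?r ?t] c[of "Suc ?i" j ?r ?t]
            c[of "Suc ?i" "Suc j" ?r ?t] i j m by auto
      qed (use r j m in auto)
    next
      \<comment> \<open>The cells \<open>m\<close> and \<open>0\<close> of both rows share a point
        because the homotopy runs through loops.\<close>
      show "{c ?i m, c ?i 0, c (Suc ?i) m, c (Suc ?i) 0} \<in> X"
      proof (rule positive_coordinates_simplex[OF complex top[of ?r 0]])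
        fix w assume "w \<in> {c ?i m, c ?i 0, c (Suc ?i) m, c (Suc ?i) 0}"
        then show "h (?r, 0) w > 0"
          using c[of ?i m ?r 1] c[of ?i 0 ?r 0] c[of "Suc ?i" m ?r 1]
            c[of "Suc ?i" 0 ?r 0] i m hl[of ?r] r by auto
      qed (use r in auto)
    qed
  qed
  \<comment> \<open>Every edge of the polygon is divided into \<open>b\<close> cells, and cell
    \<open>j\<close> belongs to the edge \<open>j div b\<close>.\<close>
  obtain b where b: "n = k * b" using n by blast
  have b0: "b > 0" using b n by (cases b) auto
  define v where "v = c 0"
  have v_pos: "?q t (v j) > 0" if "j < n" "real j \<le> t * real n" "t * real n \<le> real (Suc j)" for j t
    using c[of 0 j 0 t] that n(1) h0 by (simp add: v_def)
  have div: "j div b < k" if "j < n" for j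
    using that b b0 by (simp add: less_mult_imp_div_less)
  have v_edge: "v j = ?x (j div b) \<or> v j = ?x (Suc (j div b))" if j: "j < n" for j
  proof -
    let ?t = "real j / real n"
    have "real (b * (j div b)) \<le> real j" "real j \<le> real (b * Suc (j div b))"
      unfolding of_nat_le_iff using dividend_less_times_div[OF b0, of j] by simp_all
    then have "real (j div b) \<le> ?t * real k" "?t * real k \<le> real (Suc (j div b))"
      using b b0 k by (simp_all add: field_simps)
    then show ?thesis
      using v_pos[OF j, of ?t] n(1) polygon_piece[OF div[OF j], of ?t ?x]
      by (auto dest: edge_point_pos)
  qed
  \<comment> \<open>The corner \<open>a\<close> is an end point of the cell \<open>j\<close>, and
    there only the coordinate of \<open>?x a\<close> is positive.\<close>
  have v_corner: "v j = ?x a" if j: "j < n" "j = a * b \<or> Suc j = a * b" for j a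
  proof (rule vertex)
    show "a \<le> k" using j b b0 by (metis Suc_leI less_imp_le mult_le_cancel2)
    have "real a / real k * real n = real (a * b)" using b k by simp
    moreover have "j \<le> a * b" "a * b \<le> Suc j" using j by auto
    ultimately show "?q (real a / real k) (v j) > 0"
      using j(1) by (intro v_pos) (simp_all only: of_nat_le_iff)
  qed
  \<comment> \<open>The lift of \<open>v j\<close> is the corresponding end of the lifted edge. If
    both ends have the same image, unique lifting makes them equal (\<open>l_eq\<close>).\<close>
  define L where "L j = (if v j = ?x (j div b) then l (j div b) else l (Suc (j div b)))" for j
  have l_eq: "l i = l (Suc i)" if "i < k" "?x i = ?x (Suc i)" for i
    using lift_unique[OF E_refl l[OF that(1)]] l[OF that(1)] E_carrier that(2) by blast
  have L_right: "L j = l a" if j: "j < n" "Suc j = a * b" for j a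
  proof -
    have "a = Suc (j div b)" using j(2) b0
      by (metis Suc_diff_1 div_less_dividend div_mult_self_is_m less_Suc_eq mult.commute div_Suc mod_mult_self1_is_0 mod_mult_self2_is_0)
    then show ?thesis using v_corner[of j a] l_eq[OF div[OF j(1)]] j by (auto simp: L_def)
  qed
  have L_left: "L j = l a" if "j < n" "j = a * b" for j a
    using v_corner[of j a] that b0 by (simp add: L_def)
  have L_cases: "L j = l (j div b) \<or> L j = l (Suc (j div b))" for j
    by (simp add: L_def)
  have EC: "l (j div b) \<in> C" "l (Suc (j div b)) \<in> C" if "j < n" for j
    using l[OF div[OF that]] E_carrier by auto
  have "E (L j) (L (Suc j))" if j: "j < m" for j
  proof (cases "Suc j div b = j div b")
    case True
    then show ?thesis
      using L_cases[of j] L_cases[of "Suc j"] EC[of j] l[OF div[of j]] j m E_refl E_sym by auto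
  next
    case False
    \<comment> \<open>The edge changes only at a corner, where both cells are lifted to the same
      vertex.\<close>
    then have "Suc j = Suc j div b * b" by (metis div_Suc dvd_div_mult_self dvd_eq_mod_eq_0)
    then have "L j = l (Suc j div b)" "L (Suc j) = l (Suc j div b)"
      using L_right[of j "Suc j div b"] L_left[of "Suc j" "Suc j div b"] j m by auto
    then show ?thesis using EC[of "Suc j"] E_refl j m by auto
  qed
  moreover have "L j \<in> C \<and> p (L j) = v j" if "j < n" for j
    using EC[OF that] v_edge[OF that] by (auto simp: L_def)
  moreover have "closes v m" using closes_row[of m] by (simp add: v_def)
  ultimately have "E (L m) (L 0)"
    unfolding closes_def using m less_Suc_eq_le by (metis (no_types, lifting))
  moreover have "L m = l k" using L_right[of m k] m b by simp
  moreover have "L 0 = l 0" using L_left[of 0 0] n by simp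
  ultimately have "E (l k) (l 0)" by simp
  then show "l k = l 0" using lift_unique E_refl E_carrier loop by metis
qed

end

section \<open>The covering by gate paths\<close>

text \<open>The order is \<open>le True\<close> and its opposite is \<open>le False\<close>, so that a statement for arbitrary \<open>s\<close>
  includes its dual.\<close>

locale flag_poset =
  fixes le :: "bool \<Rightarrow> 'a \<Rightarrow> 'a \<Rightarrow> bool" and z :: 'a and s0 :: bool
  assumes le_refl: "le s x x"
    and le_trans: "le s x y \<Longrightarrow> le s y w \<Longrightarrow> le s x w"
    and le_antisym: "le s x y \<Longrightarrow> le s y x \<Longrightarrow> x = y"
    and le_dual: "le (\<not> s) x y \<longleftrightarrow> le s y x"
    and wf_le: "wfp (\<lambda>x y. le s x y \<and> x \<noteq> y)"
    and bowtie: "le s u a \<Longrightarrow> le s u b \<Longrightarrow> le s a c \<Longrightarrow> le s a d \<Longrightarrow> le s b c \<Longrightarrow> le s b d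
      \<Longrightarrow> \<exists>p. le s a p \<and> le s b p \<and> le s p c \<and> le s p d"
    and flag: "le s u a \<Longrightarrow> le s u b \<Longrightarrow> le s u c \<Longrightarrow> le s a d \<Longrightarrow> le s b d \<Longrightarrow> le s b e
      \<Longrightarrow> le s c e \<Longrightarrow> le s a f \<Longrightarrow> le s c f \<Longrightarrow> \<exists>g. le s a g \<and> le s b g \<and> le s c g"
    and z_minimal: "le s0 y z \<Longrightarrow> y = z"
begin

abbreviation lt :: "bool \<Rightarrow> 'a \<Rightarrow> 'a \<Rightarrow> bool" where
  "lt s x y \<equiv> le s x y \<and> x \<noteq> y"

text \<open>Gate paths, as lists with the last vertex \<open>u\<close> first; \<open>s\<close> is the direction in which \<open>u\<close> lies
  below the vertex \<open>w\<close> before it. The last conjunct says that \<open>w\<close> is the gate of \<open>u\<close>.\<close>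

fun nf :: "bool \<Rightarrow> 'a list \<Rightarrow> bool" where
  "nf s [] = False"
| "nf s [u] = (s = s0 \<and> u = z)"
| "nf s (u # w # T) = (lt s u w \<and> nf (\<not> s) (w # T) \<and>
     (T \<noteq> [] \<longrightarrow> \<not> (\<exists>a b. le s u a \<and> lt s a w \<and> le s b a \<and> le s b (hd T))))"

text \<open>The termwise order on gate paths that are continued to infinite sequences by repeating the last
  vertex. Only these cases of lengths can occur.\<close>

definition cover_le :: "bool \<Rightarrow> 'a list \<Rightarrow> 'a list \<Rightarrow> bool" where
  "cover_le s N N' \<longleftrightarrow>
     list_all2 (le s) N N' \<and> (\<exists>t. nf t N \<and> nf t N') \<or>
     nf s N \<and> nf (\<not> s) N' \<and> (list_all2 (le s) N (tl N') \<or> list_all2 (le s) (tl N) N')"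

section \<open>Duality and the order on gate paths\<close>

lemma nf_not_Nil: "nf s N \<Longrightarrow> N \<noteq> []"
  by auto

text \<open>Directions alternate along the list and end with \<open>s0\<close> at
  \<open>z\<close>.\<close>

lemma nf_flag: "nf s N \<Longrightarrow> s = (s0 = odd (length N))"
  by (induction s N rule: nf.induct) auto

lemma nf_flag_unique: "nf s N \<Longrightarrow> nf t N \<Longrightarrow> s = t"
  using nf_flag by blast

lemma bowtie_dual:
  assumes "le s c t" "le s d t" "le s a c" "le s a d" "le s b c" "le s b d"
  shows "\<exists>p. le s a p \<and> le s b p \<and> le s p c \<and> le s p d"
  using bowtie[of "\<not> s" t c d a b] assms by (auto simp: le_dual)

lemma flag_dual:
  assumes "le s a t" "le s b t" "le s c t" "le s d a" "le s d b" "le s e b" "le s e c"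
    "le s f a" "le s f c"
  shows "\<exists>g. le s g a \<and> le s g b \<and> le s g c"
  using flag[of "\<not> s" t a b c d e f] assms by (auto simp: le_dual)

lemma list_all2_le_dual: "list_all2 (le (\<not> s)) N N' \<longleftrightarrow> list_all2 (le s) N' N"
  by (simp add: list_all2_conv_all_nth le_dual) metis

lemma list_all2_le_refl: "list_all2 (le s) N N"
  by (simp add: list_all2_refl le_refl)

lemma list_all2_le_trans:
  "list_all2 (le s) N N' \<Longrightarrow> list_all2 (le s) N' N'' \<Longrightarrow> list_all2 (le s) N N''"
  by (rule list_all2_trans[of "le s" "le s" "le s"]) (auto intro: le_trans)

lemma cover_le_dual: "cover_le (\<not> s) N N' \<longleftrightarrow> cover_le s N' N"
  unfolding cover_le_def list_all2_le_dual by auto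

lemma cover_le_refl: "nf t N \<Longrightarrow> cover_le s N N"
  unfolding cover_le_def using list_all2_le_refl by auto

text \<open>A comparison that changes the length leads from direction \<open>s\<close> to
  \<open>\<not> s\<close>, so two such changes cannot follow each other.\<close>

lemma cover_le_trans:
  assumes "cover_le s N N'" "cover_le s N' N''"
  shows "cover_le s N N''"
proof -
  have tl: "list_all2 (le s) (tl A) (tl B)" if "list_all2 (le s) A B" for A B
    using that by (cases A; cases B) auto
  from assms(2) consider
      (same) t where "list_all2 (le s) N' N''" "nf t N'" "nf t N''"
    | (longer) "nf s N'" "nf (\<not> s) N''" "list_all2 (le s) N' (tl N'')"
    | (shorter) "nf s N'" "nf (\<not> s) N''" "list_all2 (le s) (tl N') N''"
    unfolding cover_le_def by blast
  then show ?thesis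
  proof cases
    case same
    then have "nf t' N' \<Longrightarrow> nf t' N''" for t' using nf_flag_unique[of t N' t'] by simp
    then show ?thesis
      using assms(1) list_all2_le_trans[OF _ same(1)] list_all2_le_trans[OF _ tl[OF same(1)]]
      unfolding cover_le_def by blast
  next
    case longer
    then have "\<not> nf (\<not> s) N'" using nf_flag_unique by blast
    then have "list_all2 (le s) N N'" "nf s N"
      using assms(1) longer(1) nf_flag_unique[OF longer(1)] unfolding cover_le_def by blast+
    then show ?thesis using longer list_all2_le_trans unfolding cover_le_def by blast
  next
    case shorter
    then have "\<not> nf (\<not> s) N'" using nf_flag_unique by blast
    then have "list_all2 (le s) N N'" "nf s N"
      using assms(1) shorter(1) nf_flag_unique[OF shorter(1)] unfolding cover_le_def by blast+
    then show ?thesis using shorter list_all2_le_trans[OF tl] unfolding cover_le_def by blast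
  qed
qed

lemma cover_le_nf: "cover_le s N N' \<Longrightarrow> (\<exists>t. nf t N) \<and> (\<exists>t. nf t N')"
  unfolding cover_le_def by blast

lemma cover_le_length: "cover_le s N N' \<Longrightarrow> length N' \<le> Suc (length N)"
  unfolding cover_le_def by (auto dest!: list_all2_lengthD)

lemma cover_le_tl:
  assumes "nf s (u # w # T)" shows "cover_le s (u # w # T) (w # T)"
proof -
  have "nf (\<not> s) (w # T)" using assms by simp
  then show ?thesis using assms list_all2_le_refl[of s "w # T"] unfolding cover_le_def by simp
qed

text \<open>If the lengths differ, the second entry of the longer list lies between the two
  heads.\<close>

lemma cover_le_hd:
  assumes "cover_le s N N'" shows "le s (hd N) (hd N')"
proof -
  consider "list_all2 (le s) N N'" "N \<noteq> []"
    | "nf (\<not> s) N'" "list_all2 (le s) N (tl N')" "N \<noteq> []"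
    | "nf s N" "list_all2 (le s) (tl N) N'" "N' \<noteq> []"
    using assms nf_not_Nil unfolding cover_le_def by metis
  then show ?thesis
  proof cases
    case 1 then show ?thesis by (cases N; cases N') auto
  next
    case 2
    then obtain u M v a M' where "N = u # M" "N' = v # a # M'" "le s u a" "le s a v"
      by (cases N; cases N'; cases "tl N'") (auto simp: le_dual)
    then show ?thesis using le_trans[of s u a v] by simp
  next
    case 3
    then obtain u M v a M' where "N' = u # M" "N = v # a # M'" "le s a u" "le s v a"
      by (cases N; cases N'; cases "tl N") (auto simp: le_dual)
    then show ?thesis using le_trans[of s v a u] by simp
  qed
qed

section \<open>Uniqueness of lifts\<close>

lemma nf_step: "nf s (u # w # T) \<Longrightarrow> le s u w \<and> u \<noteq> w \<and> nf (\<not> s) (w # T)"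
  by simp

lemma nf_step': "nf (\<not> s) (u # w # T) \<Longrightarrow> le s w u \<and> u \<noteq> w \<and> nf s (w # T)"
  by (simp add: le_dual)

lemma nf_gap:
  assumes "nf s (u # w # x # T)" "le s u a" "le s a w" "le s b a" "le s b x"
  shows "a = w"
  using assms by auto

text \<open>This makes \<open>w'\<close> the join of \<open>a\<close> and \<open>w\<close>. Bowtie
  gives \<open>q\<close> above \<open>a\<close> and \<open>w\<close> and below \<open>b\<close> and
  \<open>w'\<close>. The vertex \<open>x\<close> next to \<open>w\<close> lies below
  \<open>q\<close> and \<open>x'\<close>, so the gate condition at \<open>w'\<close> forces
  \<open>q = w'\<close>.\<close>

lemma nf_prev_join:
  assumes N: "nf s (u # w # T)" and N': "nf s (a # w' # T')"
    and L: "list_all2 (le s) (u # w # T) (a # w' # T')"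
    and b: "le s a b" "le s w b"
  shows "le s w' b"
proof (cases T)
  case Nil
  then show ?thesis using assms by auto
next
  case (Cons x T1)
  with L obtain x' T1' where T': "T' = x' # T1'" by (cases T') auto
  have "\<exists>q. le s a q \<and> le s w q \<and> le s q b \<and> le s q w'"
    using L b N N' by (intro bowtie[of s u]) auto
  then obtain q where q: "le s a q" "le s w q" "le s q b" "le s q w'" by blast
  have "q = w'"
  proof (rule nf_gap[OF N'[unfolded T'] q(1,4)])
    show "le s x q" using N q(2) Cons le_trans[of s x w q] by (auto simp: le_dual)
    show "le s x x'" using L Cons T' by simp
  qed
  then show ?thesis using q by simp
qed

text \<open>Dual to \<open>nf_prev_join\<close> with the two paths exchanged: \<open>x\<close> is
  the meet of \<open>w\<close> and \<open>x'\<close>.\<close>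

lemma nf_prev_meet:
  assumes N: "nf (\<not> s) (w # x # T)" and N': "nf (\<not> s) (c # x' # T')"
    and L: "list_all2 (le s) (w # x # T) (c # x' # T')"
    and b: "le s b w" "le s b x'"
  shows "le s b x"
  using nf_prev_join[OF N' N, of b] L b
  by (metis le_dual list_all2_le_dual)

text \<open>The two statements about a common direction of \<open>N\<close> and \<open>v\<close> are proved together because
  each one reduces to the other one for a shorter path.\<close>

lemma lift_unique_aux:
  "(nf t N \<longrightarrow> nf t N1 \<longrightarrow> nf t N2 \<longrightarrow> list_all2 (le s) N N1 \<longrightarrow> list_all2 (le s) N N2 \<longrightarrow>
      hd N1 = hd N2 \<longrightarrow> N1 = N2) \<and>
   (\<forall>v. nf s N \<longrightarrow> nf (\<not> s) (v # N1) \<longrightarrow> nf (\<not> s) (v # N2) \<longrightarrow>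
      list_all2 (le s) N N1 \<longrightarrow> list_all2 (le s) N N2 \<longrightarrow> N1 = N2)"
proof (induction "length N" arbitrary: N N1 N2 t rule: less_induct)
  case less
  have same_hd: "N1 = N2" if n: "nf t N" "nf t N1" "nf t N2"
    and L: "list_all2 (le s) N N1" "list_all2 (le s) N N2" and h: "hd N1 = hd N2" for t
  proof (cases "length N \<le> 1")
    case True
    then show ?thesis using n L h
      by (cases N; cases N1; cases N2) auto
  next
    case False
    then obtain u w T where N: "N = u # w # T"
      by (cases N; cases "tl N") auto
    obtain v w1 T1 where N1: "N1 = v # w1 # T1"
      using L(1) N by (auto simp: list_all2_Cons1)
    obtain w2 T2 where N2: "N2 = v # w2 # T2"
      using L(2) N h N1 by (auto simp: list_all2_Cons1)
    show ?thesis
    proof (cases "t = s")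
      case False
      then have t: "t = (\<not> s)" by simp
      \<comment> \<open>Both tails have direction \<open>s\<close> and are extended by the same
        \<open>v\<close>, so the second statement applies.\<close>
      have "w1 # T1 = w2 # T2"
        using less[of "w # T" s "w1 # T1" "w2 # T2"] n L unfolding N N1 N2 t by fastforce
      then show ?thesis using N1 N2 by simp
    next
      case True
      \<comment> \<open>Both \<open>w1\<close> and \<open>w2\<close> are the join of
        \<open>v\<close> and \<open>w\<close>.\<close>
      have "le s w1 w2" if n: "nf s N" "nf s (v # w1 # T1)" "nf s (v # w2 # T2)" and
         L: "list_all2 (le s) N (v # w1 # T1)" "list_all2 (le s) N (v # w2 # T2)" for w1 T1 w2 T2
      proof -
        show ?thesis using nf_prev_join[OF n(1,2)[unfolded N] L(1)[unfolded N], of w2] n L N by auto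
      qed
      then have "w1 = w2" using n L True N1 N2 le_antisym by blast
      moreover have "w1 # T1 = w2 # T2" if "w1 = w2"
        using less[of "w # T" "\<not> s" "w1 # T1" "w2 # T2"] n L that unfolding N N1 N2 True
        by fastforce
      ultimately show ?thesis using N1 N2 by simp
    qed
  qed
  have ext: "N1 = N2" if n: "nf s N" and n1: "nf (\<not> s) (v # N1)" and n2: "nf (\<not> s) (v # N2)"
    and L: "list_all2 (le s) N N1" "list_all2 (le s) N N2" for v
  proof (cases "length N \<le> 1")
    case True
    then show ?thesis using n n1 n2 L
      by (cases N; cases N1; cases N2) auto
  next
    case False
    then obtain w x T where N: "N = w # x # T"
      by (cases N; cases "tl N") auto
    obtain w1 x1 T1 where N1: "N1 = w1 # x1 # T1"
      using L(1) N by (auto simp: list_all2_Cons1)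
    obtain w2 x2 T2 where N2: "N2 = w2 # x2 # T2"
      using L(2) N by (auto simp: list_all2_Cons1)
    have n1': "nf s N1" and n2': "nf s N2" using n1 n2 N1 N2 by auto
    \<comment> \<open>The flag condition for \<open>w1\<close>, \<open>w2\<close> and
      \<open>x\<close>, which lie above \<open>w\<close>; the pairwise upper bounds are
      \<open>v\<close>, \<open>x2\<close> and \<open>x1\<close>.\<close>
    have "\<exists>b. le s w1 b \<and> le s w2 b \<and> le s x b"
      using n1 n2 L n unfolding N N1 N2
      by (intro flag[of s w w1 w2 x v x2 x1]) (auto simp: le_dual)
    then obtain b where b: "le s w1 b" "le s w2 b" "le s x b" by blast
    have "\<exists>a. le s w1 a \<and> le s w2 a \<and> le s a v \<and> le s a b"
      using n1 n2 L b unfolding N N1 N2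
      by (intro bowtie[of s w]) (auto simp: le_dual)
    then obtain a where a: "le s w1 a" "le s w2 a" "le s a v" "le s a b" by blast
    \<comment> \<open>As the join of \<open>w1\<close> and \<open>x\<close>, the vertex
      \<open>x1\<close> lies below \<open>b\<close>. So \<open>b\<close> is above \<open>a\<close>
      and \<open>x1\<close>, and the gate condition at \<open>w1\<close> applies; similarly for
      \<open>w2\<close>.\<close>
    have "a = w1"
      using nf_gap[OF n1[unfolded N1], of a b] a
        nf_prev_join[OF n[unfolded N] n1'[unfolded N1], of b] b L
      unfolding N N1 by (auto simp: le_dual)
    moreover have "a = w2"
      using nf_gap[OF n2[unfolded N2], of a b] a
        nf_prev_join[OF n[unfolded N] n2'[unfolded N2], of b] b L
      unfolding N N2 by (auto simp: le_dual)
    ultimately have "hd N1 = hd N2" using N1 N2 by simp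
    then show ?thesis using same_hd[OF n n1' n2' L] by simp
  qed
  show ?case using same_hd ext by blast
qed

lemmas lift_unique_same = lift_unique_aux[THEN conjunct1, rule_format]
lemmas lift_unique_ext = lift_unique_aux[THEN conjunct2, rule_format]

text \<open>In the longer lift \<open>w2\<close> is the join of \<open>a\<close> and
  \<open>w\<close>, hence below \<open>w1\<close>. As \<open>w1\<close> is also above
  \<open>v\<close>, the gate condition at \<open>a\<close> forces \<open>v = a\<close>.\<close>

lemma no_mixed_lifts:
  assumes n: "nf s N" and L1: "list_all2 (le s) N N1" and n1: "nf s N1"
    and L2: "list_all2 (le s) N M" and n2: "nf (\<not> s) (hd N1 # M)"
  shows False
proof (cases "length N \<le> 1")
  case True
  then show ?thesis using n L1 n1 L2 n2
    by (cases N; cases N1; cases M) auto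
next
  case False
  then obtain u w T where N: "N = u # w # T"
    by (cases N; cases "tl N") auto
  obtain v w1 T1 where N1: "N1 = v # w1 # T1"
    using L1 N by (auto simp: list_all2_Cons1)
  obtain a w2 T2 where M: "M = a # w2 # T2"
    using L2 N by (auto simp: list_all2_Cons1)
  have nM: "nf s M" using n2 M by simp
  have av: "le s a v" "a \<noteq> v" using n2 M N1 by (auto simp: le_dual)
  have vw: "le s v w1" using n1 N1 by auto
  have "le s w2 w1"
    using nf_prev_join[OF n[unfolded N] nM[unfolded M], of w1] L1 L2 av vw le_trans[OF av(1) vw]
    unfolding N N1 M by auto
  then have "v = a"
    using nf_gap[of "\<not> s" v a w2 T2 v w1] n2 M N1 av vw by (auto simp: le_dual le_refl)
  then show False using av by simp
qed

text \<open>Two lifts of the same kind agree by \<open>lift_unique_aux\<close>; two lifts of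
  different kinds contradict the gate condition.\<close>

lemma cover_le_unique:
  assumes "cover_le s N N1" "cover_le s N N2" "hd N1 = hd N2"
  shows "N1 = N2"
proof -
  \<comment> \<open>The three kinds of lift: as long as \<open>N\<close>, one longer
    (\<open>B\<close>), one shorter (\<open>C\<close>).\<close>
  define A where "A M \<longleftrightarrow> list_all2 (le s) N M \<and> (\<exists>t. nf t N \<and> nf t M)" for M
  define B where "B M \<longleftrightarrow> nf s N \<and> nf (\<not> s) M \<and> list_all2 (le s) N (tl M)" for M
  define C where "C M \<longleftrightarrow> nf s N \<and> nf (\<not> s) M \<and> list_all2 (le s) (tl N) M" for M
  have cases: "A M \<or> B M \<or> C M" if "cover_le s N M" for M
    using that unfolding cover_le_def A_def B_def C_def by blast
  have AA: "M = M'" if m: "A M" "A M'" "hd M = hd M'" for M M'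
  proof -
    obtain t t' where t: "nf t N" "nf t M" "nf t' N" "nf t' M'" using m unfolding A_def by blast
    then have "t = t'" using nf_flag_unique by blast
    then show ?thesis using that lift_unique_same[of t N M M' s] t unfolding A_def by blast
  qed
  have BB: "M = M'" if "B M" "B M'" "hd M = hd M'" for M M'
  proof -
    have "M \<noteq> []" "M' \<noteq> []" using that nf_not_Nil unfolding B_def by blast+
    then have M: "M = hd M # tl M" "M' = hd M # tl M'" using that(3) by (metis list.collapse)+
    then have "nf (\<not> s) (hd M # tl M)" "nf (\<not> s) (hd M # tl M')" using that B_def by auto
    then have "tl M = tl M'" using that lift_unique_ext[of s N "hd M" "tl M" "tl M'"]
      unfolding B_def by blast
    then show ?thesis using M by metis
  qed
  have CC: "M = M'" if "C M" "C M'" "hd M = hd M'" for M M'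
  proof -
    have "nf (\<not> s) (tl N)" using that nf_not_Nil unfolding C_def
      by (cases N; cases "tl N") auto
    then show ?thesis using that lift_unique_same[of "\<not> s" "tl N" M M' s] unfolding C_def by blast
  qed
  have AB: False if m: "A M" "B M'" "hd M = hd M'" for M M'
  proof -
    have "M' \<noteq> []" using m nf_not_Nil unfolding B_def by blast
    then have "M' = hd M # tl M'" using m(3) by (metis list.collapse)
    then have "nf (\<not> s) (hd M # tl M')" using m B_def by auto
    moreover obtain t where "nf t N" "nf t M" using m unfolding A_def by blast
    then have "nf s M" using m nf_flag_unique[of t N s] unfolding B_def by blast
    ultimately show ?thesis using m no_mixed_lifts[of s N M "tl M'"] unfolding A_def B_def by blast
  qed
  have AC: False if m: "A M" "C M'" "hd M = hd M'" for M M'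
  proof -
    obtain t where t: "nf t N" "nf t M" using m unfolding A_def by blast
    have n: "nf s N" and LM: "list_all2 (le s) N M"
      and nM': "nf (\<not> s) M'" and LM': "list_all2 (le s) (tl N) M'"
      using m unfolding A_def C_def by blast+
    then have nM: "nf s M" using t nf_flag_unique by blast
    have "N \<noteq> []" "tl N \<noteq> []" using n nM' LM' by auto
    then obtain u w T where N: "N = u # w # T" by (metis list.collapse)
    obtain v w1 T1 where M: "M = v # w1 # T1"
      using LM N by (auto simp: list_all2_Cons1)
    obtain T2 where M': "M' = v # T2"
      using LM' N M m(3) by (auto simp: list_all2_Cons1)
    show False
    proof (cases T)
      case Nil
      then show ?thesis using n nM nM' LM LM' unfolding N M M' by auto
    next
      case (Cons x T')
      then obtain x1 T1' where T1: "T1 = x1 # T1'" using LM N M by (auto simp: list_all2_Cons1)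
      have nM: "nf s (v # w1 # x1 # T1')" using nM unfolding M T1 .
      have "nf (\<not> s) (w # x # T')" using nf_step[OF n[unfolded N Cons]] by blast
      then have "le s x w" using nf_step' by blast
      moreover have "le s w v" using LM' unfolding N M' by simp
      moreover have "le s x x1" using LM unfolding N M Cons T1 by simp
      moreover have "le s v w1" "v \<noteq> w1" using nf_step[OF nM] by blast+
      \<comment> \<open>The vertex \<open>x\<close> lies below \<open>v\<close> and
        \<open>x1\<close>, so the gate condition at \<open>w1\<close> gives
        \<open>v = w1\<close>.\<close>
      ultimately show False
        using nf_gap[OF nM le_refl] le_trans by blast
    qed
  qed
  have BC: False if m: "B M" "C M'" "hd M = hd M'" for M M'
  proof -
    have n: "nf s N" and nM: "nf (\<not> s) M" and LM: "list_all2 (le s) N (tl M)"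
      and nM': "nf (\<not> s) M'" and LM': "list_all2 (le s) (tl N) M'"
      using m unfolding B_def C_def by blast+
    have "N \<noteq> []" "tl N \<noteq> []" using n nM' LM' by auto
    then obtain u w T where N: "N = u # w # T" by (metis list.collapse)
    obtain v a w1 T1 where M: "M = v # a # w1 # T1"
      using LM N by (cases M) (auto simp: list_all2_Cons1)
    obtain T2 where M': "M' = v # T2"
      using LM' N M m(3) by (auto simp: list_all2_Cons1)
    have ntM: "nf s (a # w1 # T1)" and av: "le s a v" using nf_step'[OF nM[unfolded M]] by blast+
    \<comment> \<open>\<open>w1\<close> is the join of \<open>a\<close> and \<open>w\<close>, and
      both lie below \<open>v\<close>.\<close>
    have "le s w1 v"
      by (rule nf_prev_join[OF n[unfolded N] ntM _ av]) (use LM LM' N M M' in simp_all)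
    then have "w1 = a"
      using nf_gap[OF nM[unfolded M], of w1 w1] nf_step[OF ntM] by (simp add: le_dual le_refl)
    then show False using nf_step[OF ntM] by blast
  qed
  note h = assms(3) assms(3)[symmetric]
  from cases[OF assms(1)] show ?thesis
  proof (elim disjE)
    assume "A N1"
    then show ?thesis
      using cases[OF assms(2)] AA[OF _ _ h(1)] AB[OF _ _ h(1)] AC[OF _ _ h(1)] by blast
  next
    assume "B N1"
    then show ?thesis
      using cases[OF assms(2)] BB[OF _ _ h(1)] AB[OF _ _ h(2)] BC[OF _ _ h(1)] by blast
  next
    assume "C N1"
    then show ?thesis
      using cases[OF assms(2)] CC[OF _ _ h(1)] AC[OF _ _ h(2)] BC[OF _ _ h(2)] by blast
  qed
qed

section \<open>Existence of lifts\<close>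

lemma maximal_exists:
  assumes "P a" shows "\<exists>m. P m \<and> (\<forall>y. P y \<longrightarrow> le s m y \<longrightarrow> y = m)"
proof -
  have "wfp (\<lambda>x y. le s y x \<and> x \<noteq> y)"
    using wf_le[of "\<not> s"] by (simp add: le_dual)
  then have "\<exists>m. P m \<and> (\<forall>y. le s m y \<and> y \<noteq> m \<longrightarrow> \<not> P y)"
    using assms unfolding wfp_eq_minimal by (metis mem_Collect_eq)
  then show ?thesis by blast
qed

text \<open>A minimal common upper bound exists by wellfoundedness. Bowtie with another upper bound
  \<open>e\<close> gives one below both, which is the minimal one.\<close>

lemma join_exists:
  assumes "le s u a" "le s u w" "le s a b" "le s w b"
  shows "\<exists>c. le s a c \<and> le s w c \<and> (\<forall>e. le s a e \<longrightarrow> le s w e \<longrightarrow> le s c e)"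
proof -
  obtain c where c: "le s a c" "le s w c"
    and min: "\<And>y. le s a y \<Longrightarrow> le s w y \<Longrightarrow> le s y c \<Longrightarrow> y = c"
    using maximal_exists[of "\<lambda>c. le s a c \<and> le s w c" b "\<not> s"] assms by (auto simp: le_dual)
  have "le s c e" if e: "le s a e" "le s w e" for e
    using bowtie[of s u a w c e] assms(1,2) c e min by metis
  then show ?thesis using c by blast
qed

text \<open>Each of the two statements reduces to the other one for the tail, whose direction is
  opposite.\<close>

lemma lift_exists_aux:
  "(\<forall>v. nf s N \<longrightarrow> lt s (hd N) v \<longrightarrow> (\<exists>N'. cover_le s N N' \<and> hd N' = v)) \<and>
   (\<forall>v. nf s N \<longrightarrow> lt s v (hd N) \<longrightarrow> (\<exists>N'. nf s N' \<and> list_all2 (le s) N' N \<and> hd N' = v))"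
proof (induction "length N" arbitrary: N s rule: less_induct)
  case less
  have away: "\<exists>N'. cover_le s N N' \<and> hd N' = v" if n: "nf s N" and v: "lt s (hd N) v" for v
  proof (cases "length N \<le> 1")
    case True
    then have N: "N = [z]" "s = s0" using n by (cases N; auto)+
    then have "cover_le s N [v, z]"
      using v unfolding cover_le_def by (auto simp: le_refl le_dual)
    then show ?thesis by (metis list.sel(1))
  next
    case False
    then obtain u w T where N: "N = u # w # T"
      by (cases N; cases "tl N") auto
    have uw: "le s u w" and uv: "le s u v" and nw: "nf (\<not> s) (w # T)" using n v N by auto
    \<comment> \<open>\<open>a\<close> will be the gate of \<open>v\<close>, and \<open>c\<close>, the join of \<open>a\<close> and \<open>w\<close>, will be the gate of \<open>a\<close>.\<close>
    define A where "A a \<longleftrightarrow> le s u a \<and> le s a v \<and> (\<exists>b. le s a b \<and> le s w b)" for a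
    have "A u" using uw uv le_refl unfolding A_def by blast
    \<comment> \<open>Maximality of \<open>a\<close> will be the gate condition at \<open>a\<close>
      in the lift.\<close>
    then obtain a where a: "A a" and a_max: "\<And>y. A y \<Longrightarrow> le s a y \<Longrightarrow> y = a"
      using maximal_exists[of A u s] by blast
    obtain b where b: "le s a b" "le s w b" and ua: "le s u a" and av: "le s a v"
      using a A_def by blast
    obtain c where c: "le s a c" "le s w c"
      and c_least: "\<And>e. le s a e \<Longrightarrow> le s w e \<Longrightarrow> le s c e"
      using join_exists[OF ua uw b] by blast
    have "\<exists>M. nf (\<not> s) M \<and> list_all2 (le s) (w # T) M \<and> hd M = c"
    proof (cases "c = w")
      case True
      then show ?thesis using nw list_all2_le_refl[of s "w # T"] by (intro exI[of _ "w # T"]) simp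
    next
      case False
      then have "lt (\<not> s) c (hd (w # T))" using c by (simp add: le_dual)
      then obtain M where "nf (\<not> s) M" "list_all2 (le (\<not> s)) M (w # T)" "hd M = c"
        using less[of "w # T" "\<not> s"] nw N by force
      then show ?thesis by (auto simp: list_all2_le_dual)
    qed
    then obtain T' where nc: "nf (\<not> s) (c # T')" and Lc: "list_all2 (le s) (w # T) (c # T')"
      by (auto simp: list_all2_Cons1)
    show ?thesis
    proof (cases "a = c")
      case True
      \<comment> \<open>Here \<open>w\<close> lies below \<open>c = a\<close>, hence below
        \<open>v\<close>, so \<open>v\<close> itself is the common upper bound; the lift is one
        vertex shorter.\<close>
      then have "A v" using c av uv le_refl le_trans unfolding A_def by blast
      then have "v = a" using a_max av by blast
      then have "cover_le s N (c # T')"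
        using n nc Lc N unfolding cover_le_def by simp
      then show ?thesis using \<open>v = a\<close> True by (metis list.sel(1))
    next
      case ac: False
      \<comment> \<open>The gate condition at \<open>c\<close>. Flag gives \<open>e\<close> below
        \<open>a'\<close>, \<open>w\<close> and \<open>x'\<close>; as \<open>x\<close> is the meet
        of \<open>w\<close> and \<open>x'\<close>, also \<open>e\<close> is below \<open>x\<close>.
        The gate condition at \<open>w\<close> then turns \<open>p\<close> into \<open>w\<close>, so
        \<open>a'\<close> is above \<open>w\<close> and hence above the join
        \<open>c\<close>.\<close>
      have "a' = c" if T': "T' \<noteq> []" and a': "le s a a'" "le s a' c" and b: "le s b a'" "le s b (hd T')"
        for a' b
      proof -
        obtain x' T1' where T': "T' = x' # T1'" using T' by (cases T') auto
        obtain x T1 where T: "T = x # T1" using T' Lc by (cases T) auto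
        have "le s x w" "le s x' c" using nw nc T T' by (auto simp: le_dual)
        have "le s x x'" using Lc T T' by simp
        have "le s u a'" using ua a' le_trans by blast
        have "\<exists>e. le s e a' \<and> le s e w \<and> le s e x'"
          using \<open>le s x x'\<close> \<open>le s x w\<close> \<open>le s u a'\<close> \<open>le s x' c\<close> a' c uw b T'
          by (intro flag_dual[of s a' c w x' u x b]) auto
        then obtain e where e: "le s e a'" "le s e w" "le s e x'" by blast
        have ex: "le s e x"
          by (rule nf_prev_meet[OF nw[unfolded T] nc[unfolded T'] Lc[unfolded T T'] e(2,3)])
        obtain p where p: "le s u p" "le s e p" "le s p a'" "le s p w"
          using bowtie_dual[OF a'(2) c(2) \<open>le s u a'\<close> uw e(1,2)] by blast
        have "p = w"
          using nf_gap[of s u w x T1 p e] n p ex unfolding N T by blast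
        then have "le s c a'" using c_least a' p by blast
        then show "a' = c" using a' le_antisym by blast
      qed
      then have na: "nf s (a # c # T')"
        using nc c ac by auto
      have La: "list_all2 (le s) N (a # c # T')" using Lc ua N by simp
      show ?thesis
      proof (cases "a = v")
        case True
        then have "cover_le s N (a # c # T')" using La n na unfolding cover_le_def by blast
        then show ?thesis using True by (metis list.sel(1))
      next
        case False
        \<comment> \<open>Such an \<open>a'\<close> shares the upper bound \<open>b\<close> with
          \<open>w\<close>, so it satisfies \<open>A\<close>.\<close>
        have "a' = a" if "le s a a'" "le s a' v" "le s a' b" "le s c b" for a' b
          using a_max[of a'] that c ua le_trans unfolding A_def by blast
        then have "nf (\<not> s) (v # a # c # T')"
          using na False av by (auto simp: le_dual)
        then have "cover_le s N (v # a # c # T')"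
          using La n unfolding cover_le_def by simp
        then show ?thesis by (metis list.sel(1))
      qed
    qed
  qed
  have toward: "\<exists>N'. nf s N' \<and> list_all2 (le s) N' N \<and> hd N' = v"
    if n: "nf s N" and v: "lt s v (hd N)" for v
  proof (cases "length N \<le> 1")
    case True
    then have N: "N = [z]" "s = s0" using n by (cases N; auto)+
    then show ?thesis using v z_minimal by auto
  next
    case False
    then obtain u w T where N: "N = u # w # T"
      by (cases N; cases "tl N") auto
    have nw: "nf (\<not> s) (w # T)" and vu: "le s v u" and uw: "lt s u w" using n N v by auto
    have vw: "lt s v w" using vu uw le_trans le_antisym by blast
    then have "lt (\<not> s) (hd (w # T)) v" by (auto simp: le_dual)
    then obtain N' where N': "cover_le (\<not> s) (w # T) N'" and hd: "hd N' = v"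
      using less[of "w # T" "\<not> s"] nw N by force
    \<comment> \<open>In the second case the tail of \<open>N'\<close> lies below
      \<open>w # T\<close>, as wanted. The others are impossible: for nonempty \<open>T\<close>, the
      vertex \<open>u\<close> would violate the gate condition at \<open>w\<close>.\<close>
    consider "list_all2 (le s) N' (w # T)" "nf (\<not> s) N'"
      | "nf s N'" "list_all2 (le s) (tl N') (w # T)"
      | "nf s N'" "list_all2 (le s) N' T"
      using N' nw nf_flag_unique unfolding cover_le_def by (auto simp: list_all2_le_dual)
    then show ?thesis
    proof cases
      case 1
      show ?thesis
      proof (cases T)
        case Nil
        then have "w = z" using nw by simp
        moreover have "N' = [v]" using 1(1) hd Nil by (auto simp: list_all2_Cons2)
        then have "v = z" using 1(2) by simp
        ultimately show ?thesis using vw by simp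
      next
        case (Cons x T1)
        obtain x' T1' where N': "N' = v # x' # T1'"
          using 1(1) hd unfolding Cons by (auto simp: list_all2_Cons2)
        have "le s x' v" using 1 N' by (auto simp: le_dual)
        then have "u = w"
          using nf_gap[of s u w x T1 u x'] n 1(1) vu uw le_trans[of s x' v u] unfolding N Cons N'
          by (auto simp: le_refl)
        then show ?thesis using uw by simp
      qed
    next
      case 2
      have "N' = v # tl N'" using hd 2 nf_not_Nil by (metis list.collapse)
      then have "list_all2 (le s) N' N"
        using 2 vu N by (metis list.rel_intros(2))
      then show ?thesis using 2 hd by blast
    next
      case 3
      obtain x T1 where T: "T = x # T1" using 3 by (cases T) auto
      then have "le s v x" using 3 hd by (cases N') auto
      then have "u = w"
        using nf_gap[of s u w x T1 u v] n vu uw unfolding N T by (auto simp: le_refl)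
      then show ?thesis using uw by simp
    qed
  qed
  show ?case using away toward by blast
qed

lemma cover_le_exists:
  assumes "nf t N" "le s (hd N) v"
  shows "\<exists>N'. cover_le s N N' \<and> hd N' = v"
proof (cases "v = hd N")
  case True
  then show ?thesis using assms cover_le_refl by blast
next
  case False
  show ?thesis
  proof (cases "t = s")
    case True
    then show ?thesis using False assms lift_exists_aux[of s N] by blast
  next
    case f: False
    then have t: "t = (\<not> s)" by simp
    obtain N' where N': "nf t N'" "list_all2 (le t) N' N" "hd N' = v"
      using lift_exists_aux[of t N] False assms t by (auto simp: le_dual)
    then have "cover_le s N N'"
      using assms(1) t unfolding cover_le_def by (auto simp: list_all2_le_dual)
    then show ?thesis using N' by blast
  qed
qed

end

section \<open>Gate paths in a simply connected complex\<close>

locale flag_complex = flag_poset le z s0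
  for le :: "bool \<Rightarrow> 'a \<Rightarrow> 'a \<Rightarrow> bool" and z s0 +
  fixes X :: "'a set set"
  assumes complex: "abstract_simplicial_complex X"
    and simply_connected: "simply_connected_space (geometric_realization X)"
    and simplex_le: "{u, v} \<in> X \<Longrightarrow> \<exists>s. le s u v"
    and le_simplex: "le s u v \<Longrightarrow> u \<in> vertices X \<Longrightarrow> {u, v} \<in> X"
    and z_vertex: "z \<in> vertices X"
begin

definition cover_adj :: "'a list \<Rightarrow> 'a list \<Rightarrow> bool" where
  "cover_adj N N' \<longleftrightarrow> (\<exists>s. cover_le s N N')"

lemma in_vertices: "{u, v} \<in> X \<Longrightarrow> u \<in> vertices X \<and> v \<in> vertices X"
  unfolding vertices_def by blast

lemma nf_hd_vertex: "nf t N \<Longrightarrow> hd N \<in> vertices X"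
proof (induction t N rule: nf.induct)
  case (2 s u)
  then show ?case using z_vertex by simp
next
  case (3 s u w T)
  then have "le (\<not> s) w u" "w \<in> vertices X" by (simp_all add: le_dual)
  then show ?case using le_simplex in_vertices by (metis list.sel(1))
qed simp

text \<open>\<open>A\<close> is lifted to \<open>D'\<close> over \<open>hd D\<close>, and this to
  \<open>B'\<close> over \<open>hd B\<close>. Uniqueness gives \<open>B' = B\<close> and then, for
  lifts from \<open>B\<close> in the opposite order, \<open>D' = D\<close>.\<close>

lemma cover_le_square:
  assumes "cover_le s A B" "cover_le s D B" "le s (hd A) (hd D)"
  shows "cover_le s A D"
proof -
  obtain t where "nf t A" using cover_le_nf assms(1) by blast
  then obtain D' where D': "cover_le s A D'" "hd D' = hd D"
    using cover_le_exists assms(3) by blast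
  obtain t where "nf t D'" using cover_le_nf D'(1) by blast
  then obtain B' where B': "cover_le s D' B'" "hd B' = hd B"
    using cover_le_exists cover_le_hd[OF assms(2)] D'(2) by metis
  have "B' = B" using cover_le_unique[OF cover_le_trans[OF D'(1) B'(1)] assms(1)] B'(2) .
  then have "cover_le (\<not> s) B D'" "cover_le (\<not> s) B D"
    using B'(1) assms(2) by (simp_all add: cover_le_dual)
  then have "D' = D" using cover_le_unique D'(2) by blast
  then show ?thesis using D'(1) by simp
qed

text \<open>Either transitivity applies, or \<open>A\<close> and \<open>D\<close> lie on the same
  side of \<open>B\<close> and the order of their heads decides how to use
  \<open>cover_le_square\<close>.\<close>

lemma cover_adj_triangle:
  assumes "cover_adj A B" "cover_adj B D" "{hd A, hd D} \<in> X"
  shows "cover_adj A D"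
proof -
  obtain s t where st: "cover_le s A B" "cover_le t B D"
    using assms unfolding cover_adj_def by blast
  show ?thesis
  proof (cases "s = t")
    case True
    then show ?thesis using st cover_le_trans unfolding cover_adj_def by blast
  next
    case False
    then have "t = (\<not> s)" by simp
    then have D: "cover_le s D B" using st(2) by (simp add: cover_le_dual)
    obtain r where r: "le r (hd A) (hd D)" using simplex_le assms(3) by blast
    show ?thesis
    proof (cases "r = s")
      case True
      then show ?thesis using cover_le_square[OF st(1) D] r unfolding cover_adj_def by blast
    next
      case False
      then have "r = (\<not> s)" by simp
      then have "le s (hd D) (hd A)" using r by (simp add: le_dual)
      then have "cover_le (\<not> s) A D"
        using cover_le_square[OF D st(1)] by (simp add: cover_le_dual)
      then show ?thesis unfolding cover_adj_def by blast
    qed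
  qed
qed

sublocale simplicial_covering X "{N. \<exists>t. nf t N}" hd cover_adj
proof
  show "abstract_simplicial_complex X" by (rule complex)
  fix A B B' D :: "'a list" and v
  show "cover_adj A B \<Longrightarrow> A \<in> {N. \<exists>t. nf t N} \<and> B \<in> {N. \<exists>t. nf t N}"
    using cover_le_nf unfolding cover_adj_def by blast
  show "A \<in> {N. \<exists>t. nf t N} \<Longrightarrow> cover_adj A A"
    using cover_le_refl unfolding cover_adj_def by blast
  show "cover_adj B A" if AB: "cover_adj A B"
  proof -
    obtain s where "cover_le s A B" using AB unfolding cover_adj_def by blast
    then have "cover_le (\<not> s) B A" by (simp add: cover_le_dual)
    then show ?thesis unfolding cover_adj_def by blast
  qed
  show "{hd A, hd B} \<in> X" if "cover_adj A B"
    using that cover_le_hd cover_le_nf le_simplex nf_hd_vertex unfolding cover_adj_def by blast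
  show "B = B'" if BB: "cover_adj A B" "cover_adj A B'" and h: "hd B = hd B'"
  proof -
    obtain s t where st: "cover_le s A B" "cover_le t A B'"
      using BB unfolding cover_adj_def by blast
    show ?thesis
    proof (cases "s = t")
      case True
      then show ?thesis using st cover_le_unique h by blast
    next
      case False
      then have t: "t = (\<not> s)" by simp
      have "le s (hd A) (hd B)" "le s (hd B) (hd A)"
        using cover_le_hd[OF st(1)] cover_le_hd[OF st(2)] h t by (simp_all add: le_dual)
      then have hA: "hd A = hd B" by (rule le_antisym)
      obtain q where "nf q A" using st cover_le_nf by blast
      then have "cover_le s A A" "cover_le t A A" using cover_le_refl by blast+
      then have "A = B" "A = B'" using cover_le_unique st hA h by metis+
      then show ?thesis by simp
    qed
  qed
  show "\<exists>B. cover_adj A B \<and> hd B = v" if "A \<in> {N. \<exists>t. nf t N}" "{hd A, v} \<in> X"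
    using that simplex_le cover_le_exists unfolding cover_adj_def by blast
  show "cover_adj A D" if "cover_adj A B" "cover_adj B D" "{hd A, hd B, hd D} \<in> X"
    using cover_adj_triangle[OF that(1,2)] simplex_face[OF complex that(3), of "{hd A, hd D}"]
    by blast
qed

text \<open>The chain from \<open>A\<close> to \<open>B\<close> projects to a closed edge path,
  which has trivial monodromy.\<close>

lemma cover_connected_unique:
  assumes "cover_adj\<^sup>*\<^sup>* A B" "hd A = hd B" shows "A = B"
proof -
  obtain n where "(cover_adj ^^ n) A B" using assms(1) rtranclp_imp_relpowp by fast
  then obtain l where l: "l 0 = A" "l n = B" "\<And>i. i < n \<Longrightarrow> cover_adj (l i) (l (Suc i))"
    unfolding relpowp_fun_conv by blast
  show ?thesis
  proof (cases "n = 0")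
    case False
    then show ?thesis
      using trivial_monodromy[OF simply_connected, of n l] l assms(2) by simp
  qed (use l in simp)
qed

lemma nf_cover_connected: "nf t N \<Longrightarrow> cover_adj\<^sup>*\<^sup>* N [z]"
proof (induction t N rule: nf.induct)
  case (3 s u w T)
  then have "cover_adj (u # w # T) (w # T)"
    using cover_le_tl unfolding cover_adj_def by blast
  moreover have "cover_adj\<^sup>*\<^sup>* (w # T) [z]" using 3 by simp
  ultimately show ?case by (rule converse_rtranclp_into_rtranclp)
qed auto

text \<open>Shortening connects every gate path to \<open>[z]\<close>, so any two gate paths are
  connected in the covering.\<close>

lemma nf_unique:
  assumes "nf t N" "nf t' N'" "hd N = hd N'" shows "N = N'"
proof -
  have "cover_adj\<^sup>*\<^sup>* [z] N'"
    using nf_cover_connected[OF assms(2)] symp_rtranclp[of cover_adj] E_sym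
    by (simp add: symp_def)
  then have "cover_adj\<^sup>*\<^sup>* N N'" using nf_cover_connected[OF assms(1)] by simp
  then show ?thesis using cover_connected_unique assms(3) by blast
qed

lemma nf_exists:
  assumes "u \<in> vertices X" shows "\<exists>N t. nf t N \<and> hd N = u"
proof (rule connected_by_edges[OF complex simply_connected z_vertex assms])
  show "\<exists>N t. nf t N \<and> hd N = z" by (intro exI[of _ "[z]"] exI[of _ s0]) simp
  show "\<exists>N t. nf t N \<and> hd N = b" if "\<exists>N t. nf t N \<and> hd N = a" "{a, b} \<in> X" for a b
    using that lift_exists E_carrier by blast
qed

definition gate_path :: "'a \<Rightarrow> 'a list" where
  "gate_path u = (SOME N. (\<exists>t. nf t N) \<and> hd N = u)"

lemma gate_path:
  assumes "u \<in> vertices X" shows "\<exists>t. nf t (gate_path u)" "hd (gate_path u) = u"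
  using someI_ex[of "\<lambda>N. (\<exists>t. nf t N) \<and> hd N = u"] nf_exists[OF assms]
  unfolding gate_path_def by blast+

lemma gate_path_hd: "nf t N \<Longrightarrow> gate_path (hd N) = N"
  using gate_path nf_hd_vertex nf_unique by blast

lemma gate_path_le:
  assumes "u \<in> vertices X" "le s u v" shows "cover_le s (gate_path u) (gate_path v)"
proof -
  obtain N where N: "cover_le s (gate_path u) N" "hd N = v"
    using cover_le_exists gate_path[OF assms(1)] assms(2) by metis
  then have "gate_path v = N" using cover_le_nf gate_path_hd by blast
  then show ?thesis using N by simp
qed

lemma length_gate_path_step:
  assumes "adjacent X u v" shows "length (gate_path v) \<le> Suc (length (gate_path u))"
proof -
  have "{u, v} \<in> X" using assms by (simp add: adjacent_def)
  then obtain s where "le s u v" "u \<in> vertices X" using simplex_le in_vertices by blast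
  then show ?thesis using gate_path_le cover_le_length by blast
qed

lemma gate_path_edge_path:
  "nf t N \<Longrightarrow> \<exists>p. edge_path X p (length N) \<and> p 1 = z \<and> p (length N) = hd N"
proof (induction t N rule: nf.induct)
  case (2 s u)
  then show ?case using z_vertex by (intro exI[of _ "\<lambda>_. z"]) (simp add: edge_path_def)
next
  case (3 s u w T)
  let ?n = "length (w # T)"
  obtain p where p: "edge_path X p ?n" "p 1 = z" "p ?n = w"
    using 3 by auto
  have uw: "le s u w" "u \<noteq> w" "u \<in> vertices X"
    using 3(2) nf_hd_vertex[OF 3(2)] by simp_all
  then have "{w, u} \<in> X" using le_simplex by (metis insert_commute)
  then have wu: "adjacent X w u" using uw by (simp add: adjacent_def)
  define q where "q = p(Suc ?n := u)"
  have q: "q (Suc ?n) = u" "\<And>i. i \<le> ?n \<Longrightarrow> q i = p i" by (simp_all add: q_def)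
  have "edge_path X q (Suc ?n)"
    using p q uw(3) wu unfolding edge_path_def
    by (auto simp: less_Suc_eq le_Suc_eq)
  moreover have "q 1 = z" using p(2) q(2)[of 1] by simp
  ultimately show ?case using q(1) by (metis length_Cons list.sel(1))
qed simp

text \<open>Read from \<open>z\<close>, the gate path is an edge path. Conversely, the length of
  gate paths grows by at most one per edge. It counts vertices, hence \<open>Suc\<close>.\<close>

lemma path_metric_gate_path:
  assumes "u \<in> vertices X" shows "Suc (path_metric X z u) = length (gate_path u)"
proof -
  obtain t where t: "nf t (gate_path u)" using gate_path assms by blast
  then obtain m where m: "length (gate_path u) = m + 1"
    by (metis nf_not_Nil length_0_conv add.commute not0_implies_Suc plus_1_eq_Suc)
  have "path_metric X z u = m"
    unfolding path_metric_def
  proof (rule Least_equality)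
    show "\<exists>p. edge_path X p (m + 1) \<and> p 1 = z \<and> p (m + 1) = u"
      using gate_path_edge_path[OF t] gate_path(2)[OF assms] m by metis
    fix n assume "\<exists>p. edge_path X p (n + 1) \<and> p 1 = z \<and> p (n + 1) = u"
    then obtain p where p: "edge_path X p (n + 1)" "p 1 = z" "p (n + 1) = u" by blast
    have "length (gate_path (p (i + 1))) \<le> i + 1" if "i \<le> n" for i
      using that
    proof (induction i)
      case 0
      have "gate_path z = [z]" using gate_path_hd[of s0 "[z]"] by simp
      then show ?case using p(2) by simp
    next
      case (Suc i)
      then have "adjacent X (p (i + 1)) (p (i + 1 + 1))" using p(1) unfolding edge_path_def by auto
      then show ?case using length_gate_path_step Suc by fastforce
    qed
    from this[of n] show "m \<le> n" using p(3) m by simp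
  qed
  then show ?thesis using m by simp
qed

text \<open>\<open>g\<close> is the gate of \<open>x\<close>: the shorter gate path of
  \<open>u\<close> lies below the tail of that of \<open>x\<close>. If \<open>v\<close> is as far
  from \<open>z\<close> as \<open>x\<close>, then \<open>h\<close> is the gate of \<open>v\<close>;
  otherwise \<open>v\<close> is below \<open>g\<close> and serves as \<open>h\<close>.\<close>

lemma peak_gate:
  assumes V: "u \<in> vertices X" "v \<in> vertices X" and le: "le s u x" "le s v x"
    and up: "path_metric X z u < path_metric X z x"
    and down: "path_metric X z v \<le> path_metric X z x"
  shows "\<exists>g h. le s u g \<and> lt s g x \<and> le s h g \<and> le s h v"
proof -
  have x: "x \<in> vertices X" using le_simplex[OF le(1) V(1)] in_vertices by blast
  have len: "length (gate_path u) < length (gate_path x)" "length (gate_path v) \<le> length (gate_path x)"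
    using up down path_metric_gate_path[OF x] V[THEN path_metric_gate_path] by simp_all
  have u: "nf (\<not> s) (gate_path x)" "list_all2 (le s) (gate_path u) (tl (gate_path x))"
    using gate_path_le[OF V(1) le(1)] len(1) unfolding cover_le_def
    by (auto dest!: list_all2_lengthD)
  obtain g T where T: "gate_path x = x # g # T"
    using u gate_path(1)[OF V(1)] gate_path(2)[OF x] nf_not_Nil
    by (cases "gate_path x"; cases "tl (gate_path x)") auto
  have ug: "le s u g"
    using u(2) T gate_path(2)[OF V(1)] by (cases "gate_path u") auto
  have gx: "lt s g x" using nf_step'[OF u(1)[unfolded T]] by auto
  consider "list_all2 (le s) (gate_path v) (x # g # T)" "nf (\<not> s) (gate_path v)"
    | "list_all2 (le s) (gate_path v) (g # T)"
  proof -
    have "\<not> list_all2 (le s) (tl (gate_path v)) (gate_path x)"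
      using len(2) T by (auto dest!: list_all2_lengthD)
    moreover have "nf t (gate_path x) \<Longrightarrow> t = (\<not> s)" for t using nf_flag_unique[OF u(1)] by simp
    ultimately show ?thesis
      using gate_path_le[OF V(2) le(2)] that unfolding cover_le_def T by auto
  qed
  then show ?thesis
  proof cases
    case 1
    then obtain h T' where "gate_path v = v # h # T'" "le s h g"
      using gate_path(2)[OF V(2)] by (auto simp: list_all2_Cons2)
    moreover from this have "le s h v" using nf_step' 1(2) by metis
    ultimately show ?thesis using ug gx by blast
  next
    case 2
    then have "le s v g" using gate_path(2)[OF V(2)] by (auto simp: list_all2_Cons2)
    then show ?thesis using ug gx le_refl by blast
  qed
qed

end

lemma strictly_increasing_after_first_ascent:
  fixes f :: "nat \<Rightarrow> nat"
  assumes k: "1 \<le> k"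
    and step: "\<And>i. 1 \<le> i \<Longrightarrow> i + 1 < k \<Longrightarrow> f i < f (i + 1) \<Longrightarrow> f (i + 1) < f (i + 2)"
  shows "\<exists>j\<in>{1..k}. (\<forall>i. 1 \<le> i \<and> i < j \<longrightarrow> f i \<ge> f (i + 1)) \<and> (\<forall>i. j \<le> i \<and> i < k \<longrightarrow> f i < f (i + 1))"
proof -
  \<comment> \<open>The alternative \<open>j = k\<close> covers a function that never
    ascends.\<close>
  define P where "P j \<longleftrightarrow> 1 \<le> j \<and> (j = k \<or> f j < f (j + 1))" for j
  define j where "j = (LEAST j. P j)"
  have Pk: "P k" using k by (simp add: P_def)
  have j: "P j" "j \<le> k" unfolding j_def using LeastI[of P k] Least_le[of P k] Pk by blast+
  have "f (i + 1) \<le> f i" if "1 \<le> i" "i < j" for i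
    using not_less_Least[of i P] that j(2) unfolding j_def[symmetric] by (auto simp: P_def)
  moreover have "f i < f (i + 1)" if "j \<le> i" "i < k" for i
    using that
  proof (induction i rule: dec_induct)
    case base
    then show ?case using j(1) by (auto simp: P_def)
  next
    case (step n)
    then show ?case using assms(2)[of n] j(1) by (auto simp: P_def)
  qed
  ultimately show ?thesis using j by (intro bexI[of _ j]) (auto simp: P_def)
qed

section \<open>The vertex order of a complex as a flag poset\<close>

definition oriented_le :: "'a set set \<Rightarrow> ('a \<Rightarrow> 's::linorder) \<Rightarrow> bool \<Rightarrow> 'a \<Rightarrow> 'a \<Rightarrow> bool" where
  "oriented_le X \<tau> s x y \<longleftrightarrow> (if s then vertex_le X \<tau> x y else vertex_le X \<tau> y x)"

lemma vertex_less_vertices: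
  "vertex_less X \<tau> x y \<Longrightarrow> x \<in> vertices X \<and> y \<in> vertices X"
  unfolding vertex_less_def adjacent_def vertices_def by blast

lemma vertex_le_trans:
  assumes C: "C_tilde_like X \<tau>" and xy: "vertex_le X \<tau> x y" and yw: "vertex_le X \<tau> y w"
  shows "vertex_le X \<tau> x w"
proof (cases "x = y \<or> y = w")
  case False
  then have "x \<in> vertices X" "y \<in> vertices X" "w \<in> vertices X"
    using xy yw vertex_less_vertices[of X \<tau>] unfolding vertex_le_def by blast+
  moreover have "trans (relation_of (vertex_le X \<tau>) (vertices X))"
    using C unfolding C_tilde_like_def partial_order_on_def preorder_on_def by blast
  ultimately show ?thesis using xy yw unfolding relation_of_def trans_def by blast
qed (use xy yw in auto)

text \<open>\<open>bowtie_free\<close> speaks of strict inequalities; if one of \<open>a\<close>,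
  \<open>b\<close> equals one of \<open>c\<close>, \<open>d\<close>, this vertex is
  \<open>p\<close>.\<close>

lemma vertex_le_bowtie:
  assumes C: "C_tilde_like X \<tau>"
    and lower: "vertex_le X \<tau> u a" "vertex_le X \<tau> u b"
    and ab: "vertex_le X \<tau> a c" "vertex_le X \<tau> a d" "vertex_le X \<tau> b c" "vertex_le X \<tau> b d"
  shows "\<exists>p. vertex_le X \<tau> a p \<and> vertex_le X \<tau> b p \<and> vertex_le X \<tau> p c \<and> vertex_le X \<tau> p d"
proof (cases "a = c \<or> a = d \<or> b = c \<or> b = d")
  case True
  then show ?thesis using ab unfolding vertex_le_def by blast
next
  case False
  have V: "a \<in> vertices X" "b \<in> vertices X" "c \<in> vertices X" "d \<in> vertices X" "u \<in> vertices X"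
    using ab lower False vertex_less_vertices[of X \<tau>] unfolding vertex_le_def by blast+
  let ?P = "{v \<in> vertices X. vertex_le X \<tau> u v}"
  have "bowtie_free ?P (vertex_le X \<tau>)" using C V(5) unfolding C_tilde_like_def by blast
  moreover have "a \<in> ?P" "b \<in> ?P" "c \<in> ?P" "d \<in> ?P"
    using V lower ab vertex_le_trans[OF C] by blast+
  moreover have "\<forall>x\<in>{a, b}. \<forall>y\<in>{c, d}. vertex_le X \<tau> x y \<and> x \<noteq> y" using ab False by blast
  ultimately have "\<exists>p\<in>?P. \<forall>x\<in>{a, b}. \<forall>y\<in>{c, d}. vertex_le X \<tau> x p \<and> vertex_le X \<tau> p y"
    unfolding bowtie_free_def by blast
  then show ?thesis by blast
qed

lemma vertex_ge_bowtie:
  assumes C: "C_tilde_like X \<tau>"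
    and upper: "vertex_le X \<tau> c u" "vertex_le X \<tau> d u"
    and ab: "vertex_le X \<tau> a c" "vertex_le X \<tau> a d" "vertex_le X \<tau> b c" "vertex_le X \<tau> b d"
  shows "\<exists>p. vertex_le X \<tau> a p \<and> vertex_le X \<tau> b p \<and> vertex_le X \<tau> p c \<and> vertex_le X \<tau> p d"
proof (cases "a = c \<or> a = d \<or> b = c \<or> b = d")
  case True
  then show ?thesis using ab unfolding vertex_le_def by blast
next
  case False
  have V: "a \<in> vertices X" "b \<in> vertices X" "c \<in> vertices X" "d \<in> vertices X" "u \<in> vertices X"
    using ab upper False vertex_less_vertices[of X \<tau>] unfolding vertex_le_def by blast+
  let ?P = "{v \<in> vertices X. vertex_le X \<tau> v u}"
  have "bowtie_free ?P (vertex_le X \<tau>)" using C V(5) unfolding C_tilde_like_def by blast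
  moreover have "a \<in> ?P" "b \<in> ?P" "c \<in> ?P" "d \<in> ?P"
    using V upper ab vertex_le_trans[OF C] by blast+
  moreover have "\<forall>x\<in>{a, b}. \<forall>y\<in>{c, d}. vertex_le X \<tau> x y \<and> x \<noteq> y" using ab False by blast
  ultimately have "\<exists>p\<in>?P. \<forall>x\<in>{a, b}. \<forall>y\<in>{c, d}. vertex_le X \<tau> x p \<and> vertex_le X \<tau> p y"
    unfolding bowtie_free_def by blast
  then show ?thesis by blast
qed

lemma vertex_le_flag:
  assumes C: "C_tilde_like X \<tau>"
    and lower: "vertex_le X \<tau> u a" "vertex_le X \<tau> u b" "vertex_le X \<tau> u c"
    and ub: "vertex_le X \<tau> a d" "vertex_le X \<tau> b d" "vertex_le X \<tau> b e" "vertex_le X \<tau> c e"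
      "vertex_le X \<tau> a f" "vertex_le X \<tau> c f"
  shows "\<exists>g. vertex_le X \<tau> a g \<and> vertex_le X \<tau> b g \<and> vertex_le X \<tau> c g"
proof (cases "u \<in> vertices X")
  case False
  then show ?thesis using lower vertex_less_vertices[of X \<tau>] unfolding vertex_le_def by metis
next
  case True
  let ?P = "{v \<in> vertices X. vertex_le X \<tau> u v}"
  have P: "v \<in> ?P" if "vertex_le X \<tau> u v" for v
    using that True vertex_less_vertices[of X \<tau>] unfolding vertex_le_def by blast
  have "upward_flag ?P (vertex_le X \<tau>)" using C True unfolding C_tilde_like_def by blast
  moreover have "a \<in> ?P" "b \<in> ?P" "c \<in> ?P" "d \<in> ?P" "e \<in> ?P" "f \<in> ?P"
    using P lower ub vertex_le_trans[OF C] by blast+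
  moreover have "upper_bounded ?P (vertex_le X \<tau>) {a, b}" "upper_bounded ?P (vertex_le X \<tau>) {b, c}"
    "upper_bounded ?P (vertex_le X \<tau>) {a, c}"
    using calculation(2-) ub unfolding upper_bounded_def by blast+
  ultimately have "upper_bounded ?P (vertex_le X \<tau>) {a, b, c}"
    unfolding upward_flag_def by blast
  then show ?thesis unfolding upper_bounded_def by blast
qed

lemma vertex_ge_flag:
  assumes C: "C_tilde_like X \<tau>"
    and upper: "vertex_le X \<tau> a u" "vertex_le X \<tau> b u" "vertex_le X \<tau> c u"
    and lb: "vertex_le X \<tau> d a" "vertex_le X \<tau> d b" "vertex_le X \<tau> e b" "vertex_le X \<tau> e c"
      "vertex_le X \<tau> f a" "vertex_le X \<tau> f c"
  shows "\<exists>g. vertex_le X \<tau> g a \<and> vertex_le X \<tau> g b \<and> vertex_le X \<tau> g c"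
proof (cases "u \<in> vertices X")
  case False
  then show ?thesis using upper vertex_less_vertices[of X \<tau>] unfolding vertex_le_def by metis
next
  case True
  let ?P = "{v \<in> vertices X. vertex_le X \<tau> v u}"
  have P: "v \<in> ?P" if "vertex_le X \<tau> v u" for v
    using that True vertex_less_vertices[of X \<tau>] unfolding vertex_le_def by blast
  have "downward_flag ?P (vertex_le X \<tau>)" using C True unfolding C_tilde_like_def by blast
  moreover have "a \<in> ?P" "b \<in> ?P" "c \<in> ?P" "d \<in> ?P" "e \<in> ?P" "f \<in> ?P"
    using P upper lb vertex_le_trans[OF C] by blast+
  moreover have "lower_bounded ?P (vertex_le X \<tau>) {a, b}" "lower_bounded ?P (vertex_le X \<tau>) {b, c}"
    "lower_bounded ?P (vertex_le X \<tau>) {a, c}"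
    using calculation(2-) lb unfolding lower_bounded_def by blast+
  ultimately have "lower_bounded ?P (vertex_le X \<tau>) {a, b, c}"
    unfolding downward_flag_def by blast
  then show ?thesis unfolding lower_bounded_def by blast
qed

text \<open>Types change strictly along the order and lie in the finite set \<open>S\<close>, so
  counting the types on one side gives a rank.\<close>

lemma wfp_oriented_le:
  assumes "complex_of_type S X \<tau>"
  shows "wfp (\<lambda>x y. oriented_le X \<tau> s x y \<and> x \<noteq> y)"
proof -
  have fin: "finite S" and \<tau>: "\<And>v. v \<in> vertices X \<Longrightarrow> \<tau> v \<in> S"
    using assms unfolding complex_of_type_def by blast+
  let ?m = "\<lambda>y. card {t \<in> S. if s then t < \<tau> y else \<tau> y < t}"
  have "?m x < ?m y" if "oriented_le X \<tau> s x y \<and> x \<noteq> y" for x y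
  proof (rule psubset_card_mono)
    have less: "if s then \<tau> x < \<tau> y else \<tau> y < \<tau> x" and "x \<in> vertices X"
      using that vertex_less_vertices[of X \<tau>] unfolding oriented_le_def vertex_le_def vertex_less_def
      by (metis vertex_less_def)+
    then show "{t \<in> S. if s then t < \<tau> x else \<tau> x < t} \<subset> {t \<in> S. if s then t < \<tau> y else \<tau> y < t}"
      using \<tau>[of x] by (cases s) (auto intro: less_trans)
  qed (use fin in simp)
  then show ?thesis by (intro wfp_if_convertible_to_nat[of _ ?m]) blast
qed

lemma flag_complex_oriented_le:
  assumes S: "complex_of_type S X \<tau>" and C: "C_tilde_like X \<tau>" and z: "extremal S X \<tau> z"
  shows "\<exists>s0. flag_complex (oriented_le X \<tau>) z s0 X"
proof -
  have fin: "finite S" and \<tau>: "\<And>v. v \<in> vertices X \<Longrightarrow> \<tau> v \<in> S"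
    and X: "abstract_simplicial_complex X"
    and types: "\<And>u v. adjacent X u v \<Longrightarrow> \<tau> u \<noteq> \<tau> v"
    using S unfolding complex_of_type_def by blast+
  have zV: "z \<in> vertices X" using z unfolding extremal_def by blast
  \<comment> \<open>The order is reversed if \<open>z\<close> does not have minimal type, so that
    \<open>z\<close> is minimal in either case.\<close>
  define s0 where "s0 \<longleftrightarrow> \<tau> z = Min S"
  have "flag_complex (oriented_le X \<tau>) z s0 X"
  proof
    fix s x y w u a b c d e f
    show "oriented_le X \<tau> s x x" by (simp add: oriented_le_def vertex_le_def)
    show "oriented_le X \<tau> s x y \<Longrightarrow> oriented_le X \<tau> s y w \<Longrightarrow> oriented_le X \<tau> s x w"
      using vertex_le_trans[OF C] unfolding oriented_le_def by (cases s) auto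
    show "oriented_le X \<tau> s x y \<Longrightarrow> oriented_le X \<tau> s y x \<Longrightarrow> x = y"
      unfolding oriented_le_def vertex_le_def vertex_less_def by (cases s) auto
    show "oriented_le X \<tau> (\<not> s) x y = oriented_le X \<tau> s y x" by (simp add: oriented_le_def)
    show "wfp (\<lambda>x y. oriented_le X \<tau> s x y \<and> x \<noteq> y)" by (rule wfp_oriented_le[OF S])
    show "\<exists>p. oriented_le X \<tau> s a p \<and> oriented_le X \<tau> s b p \<and> oriented_le X \<tau> s p c \<and> oriented_le X \<tau> s p d"
      if "oriented_le X \<tau> s u a" "oriented_le X \<tau> s u b" "oriented_le X \<tau> s a c"
        "oriented_le X \<tau> s a d" "oriented_le X \<tau> s b c" "oriented_le X \<tau> s b d"
    proof (cases s)
      case True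
      then show ?thesis using that vertex_le_bowtie[OF C, of u a b c d] by (simp add: oriented_le_def)
    next
      case False
      then show ?thesis using that vertex_ge_bowtie[OF C, of a u b c d]
        by (auto simp add: oriented_le_def)
    qed
    show "\<exists>g. oriented_le X \<tau> s a g \<and> oriented_le X \<tau> s b g \<and> oriented_le X \<tau> s c g"
      if "oriented_le X \<tau> s u a" "oriented_le X \<tau> s u b" "oriented_le X \<tau> s u c"
        "oriented_le X \<tau> s a d" "oriented_le X \<tau> s b d" "oriented_le X \<tau> s b e"
        "oriented_le X \<tau> s c e" "oriented_le X \<tau> s a f" "oriented_le X \<tau> s c f"
    proof (cases s)
      case True
      then show ?thesis using that vertex_le_flag[OF C, of u a b c d e f] by (simp add: oriented_le_def)
    next
      case False
      then show ?thesis using that vertex_ge_flag[OF C, of a u b c d e f] by (simp add: oriented_le_def)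
    qed
    show "y = z" if y: "oriented_le X \<tau> s0 y z"
    proof (rule ccontr)
      assume "y \<noteq> z"
      then have "y \<in> vertices X" and less: "if s0 then \<tau> y < \<tau> z else \<tau> z < \<tau> y"
        using y vertex_less_vertices[of X \<tau>] unfolding oriented_le_def vertex_le_def
        by (metis vertex_less_def)+
      then have "Min S \<le> \<tau> y" "\<tau> y \<le> Max S" using fin \<tau> by auto
      then show False using less z unfolding s0_def extremal_def by (auto split: if_splits)
    qed
    show "abstract_simplicial_complex X" by (rule X)
    show "simply_connected_space (geometric_realization X)" using C unfolding C_tilde_like_def by blast
    show "\<exists>s. oriented_le X \<tau> s u x" if "{u, x} \<in> X"
    proof (cases "u = x")
      case True
      then show ?thesis by (simp add: oriented_le_def vertex_le_def)
    next
      case False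
      then have "adjacent X u x" "adjacent X x u" using that by (simp_all add: adjacent_def insert_commute)
      then have "vertex_less X \<tau> u x \<or> vertex_less X \<tau> x u"
        using types[of u x] unfolding vertex_less_def by auto
      then show ?thesis
        unfolding oriented_le_def vertex_le_def by (metis (full_types))
    qed
    show "{u, x} \<in> X" if "oriented_le X \<tau> s u x" "u \<in> vertices X"
    proof (cases "u = x")
      case True
      then show ?thesis using that(2) unfolding vertices_def by (auto intro: simplex_face[OF X])
    next
      case False
      then show ?thesis using that(1)
        unfolding oriented_le_def vertex_le_def vertex_less_def adjacent_def
        by (cases s) (auto simp: insert_commute)
    qed
    show "z \<in> vertices X" by (rule zV)
  qed
  then show ?thesis by blast
qed

lemma vertices_lk:
  assumes "abstract_simplicial_complex X"
  shows "v \<in> vertices (lk_minus X \<tau> x) \<longleftrightarrow> vertex_less X \<tau> v x"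
    and "v \<in> vertices (lk_plus X \<tau> x) \<longleftrightarrow> vertex_less X \<tau> x v"
proof -
  have "{v} \<in> link X x" if "{v, x} \<in> X" "v \<noteq> x"
    using that simplex_face[OF assms that(1), of "{v}"] unfolding link_def
    by (auto simp: insert_commute)
  then have l: "{v} \<in> link X x" if "vertex_less X \<tau> v x \<or> vertex_less X \<tau> x v"
    using that unfolding vertex_less_def adjacent_def by (auto simp: insert_commute)
  show "v \<in> vertices (lk_minus X \<tau> x) \<longleftrightarrow> vertex_less X \<tau> v x"
    using l unfolding lk_minus_def full_subcomplex_def vertices_def by blast
  show "v \<in> vertices (lk_plus X \<tau> x) \<longleftrightarrow> vertex_less X \<tau> x v"
    using l unfolding lk_plus_def full_subcomplex_def vertices_def by blast
qed

theorem proposition3p15: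
  fixes S :: "'s::linorder set" and X :: "'a set set" and \<tau> :: "'a \<Rightarrow> 's"
    and x :: "nat \<Rightarrow> 'a" and k :: nat and z :: 'a
  assumes "complex_of_type S X \<tau>"
    and "C_tilde_like X \<tau>"
    and "locally_determined S X \<tau>"
    and "local_normal_form_path X \<tau> x k"
    and "extremal S X \<tau> z"
  shows "\<exists>j\<in>{1..k}.
    (\<forall>i. 1 \<le> i \<and> i < j \<longrightarrow> path_metric X z (x i) \<ge> path_metric X z (x (i + 1))) \<and>
    (\<forall>i. j \<le> i \<and> i < k \<longrightarrow> path_metric X z (x i) < path_metric X z (x (i + 1)))"
proof (rule strictly_increasing_after_first_ascent[where f = "\<lambda>i. path_metric X z (x i)"])
  obtain s0 where "flag_complex (oriented_le X \<tau>) z s0 X"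
    using flag_complex_oriented_le[OF assms(1,2,5)] ..
  then interpret flag_complex "oriented_le X \<tau>" z s0 X .
  have ud: "up_down_path X \<tau> x k" using assms(4) unfolding local_normal_form_path_def by blast
  then have ep: "edge_path X x k" unfolding up_down_path_def by blast
  then show "1 \<le> k" unfolding edge_path_def by blast
  fix i assume i: "1 \<le> i" "i + 1 < k" and up: "path_metric X z (x i) < path_metric X z (x (i + 1))"
  show "path_metric X z (x (i + 1)) < path_metric X z (x (i + 2))"
  \<comment> \<open>Otherwise \<open>peak_gate\<close> at \<open>x (i + 1)\<close>, in the order or
    its opposite, yields the vertices that a local normal form excludes.\<close>
  proof (rule ccontr)
    assume "\<not> path_metric X z (x (i + 1)) < path_metric X z (x (i + 2))"
    then have down: "path_metric X z (x (i + 2)) \<le> path_metric X z (x (i + 1))" by simp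
    let ?u = "x i" and ?x = "x (i + 1)" and ?v = "x (i + 2)"
    have V: "?u \<in> vertices X" "?v \<in> vertices X" using ep i unfolding edge_path_def by auto
    have adj: "adjacent X ?u ?x" using ep i unfolding edge_path_def by auto
    then have "\<tau> ?u \<noteq> \<tau> ?x" using assms(1) unfolding complex_of_type_def by blast
    then have "vertex_less X \<tau> ?u ?x \<or> vertex_less X \<tau> ?x ?u"
      using adj by (auto simp: vertex_less_def adjacent_def insert_commute)
    moreover have range: "2 \<le> i + 1 \<and> i + 1 \<le> k - 1" "i + 1 - 1 = i" "i + 1 + 1 = i + 2"
      using i by auto
    moreover have "vertex_less X \<tau> ?u ?x \<Longrightarrow> vertex_less X \<tau> ?v ?x"
      "vertex_less X \<tau> ?x ?u \<Longrightarrow> vertex_less X \<tau> ?x ?v"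
      using ud[unfolded up_down_path_def, THEN conjunct2, rule_format, OF range(1)]
      unfolding range by blast+
    ultimately consider "vertex_less X \<tau> ?u ?x" "vertex_less X \<tau> ?v ?x"
      | "vertex_less X \<tau> ?x ?u" "vertex_less X \<tau> ?x ?v" by blast
    then show False
    proof cases
      case 1
      then have "oriented_le X \<tau> True ?u ?x" "oriented_le X \<tau> True ?v ?x"
        by (simp_all add: oriented_le_def vertex_le_def)
      then obtain g h where gh: "vertex_le X \<tau> ?u g" "vertex_le X \<tau> g ?x" "g \<noteq> ?x"
          "vertex_le X \<tau> h g" "vertex_le X \<tau> h ?v"
        using peak_gate[OF V _ _ up down, of True] by (auto simp: oriented_le_def)
      have "vertex_less X \<tau> g ?x" using gh by (simp add: vertex_le_def)
      moreover have "vertex_le X \<tau> h ?x" using vertex_le_trans[OF assms(2) gh(4,2)] .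
      \<comment> \<open>\<open>lk_minus\<close> has only vertices strictly below
        \<open>?x\<close>.\<close>
      moreover have "h \<noteq> ?x" using gh(2,3,4) le_antisym[of True] by (auto simp: oriented_le_def)
      ultimately have "{?u, g, h, ?v} \<subseteq> vertices (lk_minus X \<tau> ?x)"
        using 1 by (simp add: vertices_lk[OF complex] vertex_le_def)
      then show False
        using assms(4)[unfolded local_normal_form_path_def, THEN conjunct2, rule_format, OF range(1)]
          1 gh unfolding range by blast
    next
      case 2
      then have "oriented_le X \<tau> False ?u ?x" "oriented_le X \<tau> False ?v ?x"
        by (simp_all add: oriented_le_def vertex_le_def)
      then obtain g h where gh: "vertex_le X \<tau> g ?u" "vertex_le X \<tau> ?x g" "g \<noteq> ?x"
          "vertex_le X \<tau> g h" "vertex_le X \<tau> ?v h"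
        using peak_gate[OF V _ _ up down, of False] by (auto simp: oriented_le_def)
      have "vertex_less X \<tau> ?x g" using gh by (simp add: vertex_le_def)
      moreover have "vertex_le X \<tau> ?x h" using vertex_le_trans[OF assms(2) gh(2,4)] .
      moreover have "h \<noteq> ?x" using gh(2,3,4) le_antisym[of True] by (auto simp: oriented_le_def)
      ultimately have "{?u, g, h, ?v} \<subseteq> vertices (lk_plus X \<tau> ?x)"
        using 2 by (auto simp: vertices_lk[OF complex] vertex_le_def)
      then show False
        using assms(4)[unfolded local_normal_form_path_def, THEN conjunct2, rule_format, OF range(1)]
          2 gh unfolding range by blast
    qed
  qed
qed

end
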